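(* Let $(B,g_B)$ and $(F,g_F)$ be pseudo-Riemannian manifolds with $\dim F>1$, let $f:B\to\mathbb{R}$ be a positive smooth function, and let $M=B\times_f F$ be the warped product with metric $\tilde g=g_B\oplus f^2g_F$. Suppose that $(M,\tilde g)$ is a gradient Yamabe soliton with potential function $h:M\to\mathbb{R}$, and that there exists a pair of orthogonal vectors $(X_i,X_j)$ of the base $B$ such that $\mathrm{Hess}_{g_B}(f)(X_i,X_j)\neq 0$. Then $h$ depends only on the base, i.e. $h(x,y)$ is independent of $y\in F$.
   Context: A pseudo-Riemannian manifold $(M,g)$ is a gradient Yamabe soliton with potential function $h\in C^\infty(M)$ if there is a real constant $\rho$ such that $(S_g-\rho)g=\mathrm{Hess}_g(h)$, where $S_g$ is the scalar curvature of $g$ and $\mathrm{Hess}_g(h)$ is the Hessian of $h$. The warped product $B\times_f F$ is the product manifold $B\times F$ with metric $\tilde g=g_B\oplus f^2g_F$, i.e. $\tilde g=\pi_B^*g_B+(f\circ\pi_B)^2\pi_F^*g_F$, where $\pi_B,\pi_F$ are the projections.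
   Formalization: The manifolds B and F are assumed connected (the usual convention, not stated); without this the claim fails, e.g. h may take different constants on different components of F, and the Hessian condition on one component of B says nothing about the others. *)

theory Defs
  imports "HOL-Analysis.Analysis"
begin

primrec n_smooth_on ::
  "nat \<Rightarrow> 'e::real_normed_vector set \<Rightarrow> ('e \<Rightarrow> 'c::real_normed_vector) \<Rightarrow> bool" where
  "n_smooth_on 0 S f \<longleftrightarrow> continuous_on S f"
| "n_smooth_on (Suc n) S f \<longleftrightarrow>
     (\<forall>x\<in>S. f differentiable (at x)) \<and>
     (\<forall>u. n_smooth_on n S (\<lambda>x. frechet_derivative f (at x) u))"

text \<open>To be used on open sets only.\<close>

definition smooth_on ::
  "'e::real_normed_vector set \<Rightarrow> ('e \<Rightarrow> 'c::real_normed_vector) \<Rightarrow> bool" where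
  "smooth_on S f \<longleftrightarrow> (\<forall>n. n_smooth_on n S f)"

text \<open>
  A manifold is a Hausdorff, second countable topological space (a type), together with a smooth
  atlas modelled on a Euclidean space. A chart is a pair of an open domain and a coordinate map;
  the values of the coordinate map outside the domain are irrelevant.
\<close>

type_synonym ('a, 'e) chart = "'a set \<times> ('a \<Rightarrow> 'e)"

definition is_chart :: "('a::topological_space, 'e::euclidean_space) chart \<Rightarrow> bool" where
  "is_chart = (\<lambda>(U, \<phi>). open U \<and> open (\<phi> ` U) \<and> homeomorphism U (\<phi> ` U) \<phi> (inv_into U \<phi>))"

definition smooth_atlas ::
  "('a::{t2_space, second_countable_topology}, 'e::euclidean_space) chart set \<Rightarrow> bool" where
  "smooth_atlas A \<longleftrightarrow>
     (\<forall>\<kappa>\<in>A. is_chart \<kappa>) \<and>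
     (\<Union>\<kappa>\<in>A. fst \<kappa>) = UNIV \<and>
     (\<forall>(U, \<phi>)\<in>A. \<forall>(V, \<psi>)\<in>A. smooth_on (\<phi> ` (U \<inter> V)) (\<psi> \<circ> inv_into U \<phi>))"

definition smooth_fun_on ::
  "('a::topological_space, 'e::euclidean_space) chart set \<Rightarrow> 'a set \<Rightarrow> ('a \<Rightarrow> real) \<Rightarrow> bool" where
  "smooth_fun_on A W h \<longleftrightarrow> (\<forall>(U, \<phi>)\<in>A. smooth_on (\<phi> ` (U \<inter> W)) (h \<circ> inv_into U \<phi>))"

definition smooth_near ::
  "('a::topological_space, 'e::euclidean_space) chart set \<Rightarrow> 'a \<Rightarrow> ('a \<Rightarrow> real) \<Rightarrow> bool" where
  "smooth_near A p h \<longleftrightarrow> (\<exists>W. open W \<and> p \<in> W \<and> smooth_fun_on A W h)"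

text \<open>
  Tangent vectors at \<open>p\<close> are directional derivatives acting on the functions that are smooth in a
  neighbourhood of \<open>p\<close>; they are set to 0 on all other functions, so that equal tangent vectors are
  equal as HOL functions.
\<close>

type_synonym 'a tvec = "('a \<Rightarrow> real) \<Rightarrow> real"

definition coord_tvec ::
  "('a::topological_space, 'e::euclidean_space) chart set \<Rightarrow> ('a, 'e) chart \<Rightarrow> 'a \<Rightarrow> 'e \<Rightarrow> 'a tvec" where
  "coord_tvec A \<kappa> p u =
     (\<lambda>h. if smooth_near A p h
          then frechet_derivative (h \<circ> inv_into (fst \<kappa>) (snd \<kappa>)) (at (snd \<kappa> p)) u
          else 0)"

definition tangent_space ::
  "('a::topological_space, 'e::euclidean_space) chart set \<Rightarrow> 'a \<Rightarrow> 'a tvec set" where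
  "tangent_space A p = {coord_tvec A \<kappa> p u |\<kappa> u. \<kappa> \<in> A \<and> p \<in> fst \<kappa>}"

definition components :: "('a, 'e::euclidean_space) chart \<Rightarrow> 'a tvec \<Rightarrow> 'e" where
  "components \<kappa> v = (\<Sum>b\<in>Basis. v (\<lambda>q. snd \<kappa> q \<bullet> b) *\<^sub>R b)"

definition push_forward :: "('a \<Rightarrow> 'b) \<Rightarrow> 'a tvec \<Rightarrow> 'b tvec" where
  "push_forward F v = (\<lambda>h. v (h \<circ> F))"

text \<open>Only the values of a metric \<open>g p\<close> on the tangent space at \<open>p\<close> are meaningful.\<close>

type_synonym 'a metric = "'a \<Rightarrow> 'a tvec \<Rightarrow> 'a tvec \<Rightarrow> real"

definition local_metric ::
  "('a::topological_space, 'e::euclidean_space) chart set \<Rightarrow> ('a, 'e) chart \<Rightarrow> 'a metric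
     \<Rightarrow> 'e \<Rightarrow> 'e \<Rightarrow> 'e \<Rightarrow> real" where
  "local_metric A \<kappa> g x u v =
     (let p = inv_into (fst \<kappa>) (snd \<kappa>) x in g p (coord_tvec A \<kappa> p u) (coord_tvec A \<kappa> p v))"

text \<open>
  Constancy of the index of the metric is not listed: it follows from continuity and
  nondegeneracy on every connected manifold.
\<close>

definition pseudo_riemannian_metric ::
  "('a::topological_space, 'e::euclidean_space) chart set \<Rightarrow> 'a metric \<Rightarrow> bool" where
  "pseudo_riemannian_metric A g \<longleftrightarrow>
     (\<forall>p. \<forall>v\<in>tangent_space A p. \<forall>w\<in>tangent_space A p. g p v w = g p w v) \<and>
     (\<forall>p. \<forall>v\<in>tangent_space A p. \<forall>w\<in>tangent_space A p. \<forall>z\<in>tangent_space A p. \<forall>a b.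
        g p (\<lambda>h. a * v h + b * w h) z = a * g p v z + b * g p w z) \<and>
     (\<forall>p. \<forall>v\<in>tangent_space A p. (\<forall>w\<in>tangent_space A p. g p v w = 0) \<longrightarrow> v = (\<lambda>_. 0)) \<and>
     (\<forall>\<kappa>\<in>A. \<forall>u v. smooth_on (snd \<kappa> ` fst \<kappa>) (\<lambda>x. local_metric A \<kappa> g x u v))"

text \<open>
  Local geometry of a metric \<open>G x u v\<close> on an open subset of a Euclidean space. Vectors are regarded
  as constant (hence commuting) coordinate vector fields, and \<open>christoffel G x u v\<close> is the value
  at \<open>x\<close> of the Levi-Civita derivative of \<open>v\<close> in direction \<open>u\<close>, given by the Koszul formula.
\<close>

definition dirder :: "('e::real_normed_vector \<Rightarrow> 'c::real_normed_vector) \<Rightarrow> 'e \<Rightarrow> 'e \<Rightarrow> 'c" where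
  "dirder f x u = frechet_derivative f (at x) u"

definition sharp :: "('e \<Rightarrow> 'e \<Rightarrow> 'e \<Rightarrow> real) \<Rightarrow> 'e \<Rightarrow> ('e \<Rightarrow> real) \<Rightarrow> 'e" where
  "sharp G x \<alpha> = (THE z. \<forall>w. G x z w = \<alpha> w)"

definition christoffel ::
  "('e::euclidean_space \<Rightarrow> 'e \<Rightarrow> 'e \<Rightarrow> real) \<Rightarrow> 'e \<Rightarrow> 'e \<Rightarrow> 'e \<Rightarrow> 'e" where
  "christoffel G x u v =
     sharp G x (\<lambda>w. (dirder (\<lambda>y. G y v w) x u + dirder (\<lambda>y. G y u w) x v
                     - dirder (\<lambda>y. G y u v) x w) / 2)"

definition local_hessian ::
  "('e::euclidean_space \<Rightarrow> 'e \<Rightarrow> 'e \<Rightarrow> real) \<Rightarrow> ('e \<Rightarrow> real) \<Rightarrow> 'e \<Rightarrow> 'e \<Rightarrow> 'e \<Rightarrow> real" where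
  "local_hessian G h x u v =
     dirder (\<lambda>y. dirder h y v) x u - dirder h x (christoffel G x u v)"

text \<open>
  Sign convention \<open>R(u,v)w = \<nabla>\<^sub>u\<nabla>\<^sub>vw - \<nabla>\<^sub>v\<nabla>\<^sub>uw\<close> (for commuting fields) and
  \<open>Ric(v,w) = tr (u \<mapsto> R(u,v)w)\<close>, so that round spheres have positive scalar curvature.
\<close>

definition curvature ::
  "('e::euclidean_space \<Rightarrow> 'e \<Rightarrow> 'e \<Rightarrow> real) \<Rightarrow> 'e \<Rightarrow> 'e \<Rightarrow> 'e \<Rightarrow> 'e \<Rightarrow> 'e" where
  "curvature G x u v w =
     dirder (\<lambda>y. christoffel G y v w) x u + christoffel G x u (christoffel G x v w)
     - (dirder (\<lambda>y. christoffel G y u w) x v + christoffel G x v (christoffel G x u w))"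

definition ricci :: "('e::euclidean_space \<Rightarrow> 'e \<Rightarrow> 'e \<Rightarrow> real) \<Rightarrow> 'e \<Rightarrow> 'e \<Rightarrow> 'e \<Rightarrow> real" where
  "ricci G x v w = (\<Sum>b\<in>Basis. curvature G x b v w \<bullet> b)"

definition local_scalar_curvature ::
  "('e::euclidean_space \<Rightarrow> 'e \<Rightarrow> 'e \<Rightarrow> real) \<Rightarrow> 'e \<Rightarrow> real" where
  "local_scalar_curvature G x = (\<Sum>b\<in>Basis. sharp G x (ricci G x b) \<bullet> b)"

text \<open>
  The Hessian tensor and the scalar curvature at a point \<open>p\<close> of the manifold, computed in a chart
  \<open>\<kappa>\<close> around \<open>p\<close>; the values do not depend on the choice of \<open>\<kappa>\<close>.
\<close>

definition hessian ::
  "('a::topological_space, 'e::euclidean_space) chart set \<Rightarrow> ('a, 'e) chart \<Rightarrow> 'a metric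
     \<Rightarrow> ('a \<Rightarrow> real) \<Rightarrow> 'a \<Rightarrow> 'a tvec \<Rightarrow> 'a tvec \<Rightarrow> real" where
  "hessian A \<kappa> g h p v w =
     local_hessian (local_metric A \<kappa> g) (h \<circ> inv_into (fst \<kappa>) (snd \<kappa>)) (snd \<kappa> p)
       (components \<kappa> v) (components \<kappa> w)"

definition scalar_curvature ::
  "('a::topological_space, 'e::euclidean_space) chart set \<Rightarrow> ('a, 'e) chart \<Rightarrow> 'a metric \<Rightarrow> 'a \<Rightarrow> real"
where
  "scalar_curvature A \<kappa> g p = local_scalar_curvature (local_metric A \<kappa> g) (snd \<kappa> p)"

definition gradient_yamabe_soliton ::
  "('a::topological_space, 'e::euclidean_space) chart set \<Rightarrow> 'a metric \<Rightarrow> ('a \<Rightarrow> real) \<Rightarrow> bool" where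
  "gradient_yamabe_soliton A g h \<longleftrightarrow>
     smooth_fun_on A UNIV h \<and>
     (\<exists>\<rho>. \<forall>\<kappa>\<in>A. \<forall>p\<in>fst \<kappa>. \<forall>v\<in>tangent_space A p. \<forall>w\<in>tangent_space A p.
        (scalar_curvature A \<kappa> g p - \<rho>) * g p v w = hessian A \<kappa> g h p v w)"

definition product_atlas ::
  "('a, 'e) chart set \<Rightarrow> ('b, 'd) chart set \<Rightarrow> ('a \<times> 'b, 'e \<times> 'd) chart set" where
  "product_atlas A A' = {(U \<times> V, map_prod \<phi> \<psi>) |U \<phi> V \<psi>. (U, \<phi>) \<in> A \<and> (V, \<psi>) \<in> A'}"

definition warped_metric ::
  "'a metric \<Rightarrow> ('a \<Rightarrow> real) \<Rightarrow> 'b metric \<Rightarrow> ('a \<times> 'b) metric" where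
  "warped_metric gB f gF = (\<lambda>p v w.
     gB (fst p) (push_forward fst v) (push_forward fst w)
     + (f (fst p))\<^sup>2 * gF (snd p) (push_forward snd v) (push_forward snd w))"

end

theory Submission
  imports Defs
begin

text \<open>
  Horizontal and vertical vectors are orthogonal for the warped metric, and the Hessian of the
  potential function of a soliton vanishes on orthogonal pairs. Since \<open>\<nabla>\<^sub>X V = (X f / f) V\<close> for
  horizontal \<open>X\<close> and vertical \<open>V\<close> (\<open>christoffel_mixed\<close>), the mixed part of the Hessian vanishes exactly
  when \<open>X (V h) = (X f / f) (V h)\<close>, that is, when \<open>(V h) / f\<close> is constant along the base. Integrating
  along the fibre (\<open>fibre_difference_proportional\<close>), and using that base and fibre are connected
  (\<open>rectangle_identity\<close>), the quotient \<open>c = (h (x, y) - h (x, y')) / f x\<close> depends on \<open>y\<close> and \<open>y'\<close> only.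

  On horizontal vectors the Hessian of \<open>h\<close> at \<open>(x, y)\<close> is the base Hessian of \<open>h (_, y)\<close>
  (\<open>local_hessian_horizontal\<close>). For the given orthogonal pair \<open>(X, Y)\<close> it is 0 both for \<open>y\<close> and for
  \<open>y'\<close>. Subtracting the two gives \<open>c * Hess f (X, Y) = 0\<close>; hence \<open>c = 0\<close>, which is the claim.

  Most of the work consists in translating between tangent vectors, which are derivations, and their coordinates in product charts
  (\<open>push_forward_coord_tvec\<close>, \<open>components_map_prod\<close>, \<open>local_metric_warped\<close>), where the warped metric takes
  its familiar form and the Christoffel symbols can be read off from the Koszul formula.
\<close>

section \<open>Smooth functions on open sets\<close>

lemma dirder_cong_open:
  assumes "open S" "x \<in> S" "\<And>y. y \<in> S \<Longrightarrow> f y = g y"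
  shows "dirder f x = dirder g x"
proof -
  have "(f has_derivative D) (at x) \<longleftrightarrow> (g has_derivative D) (at x)" for D
    using assms has_derivative_transform_within_open[of f D x UNIV S g]
      has_derivative_transform_within_open[of g D x UNIV S f] by auto
  then show ?thesis
    unfolding dirder_def frechet_derivative_def by simp
qed

lemma dirder_eqI: "(f has_derivative D) (at x) \<Longrightarrow> dirder f x = D"
  unfolding dirder_def using frechet_derivative_at by force

lemma has_derivative_dirder: "f differentiable (at x) \<Longrightarrow> (f has_derivative dirder f x) (at x)"
  unfolding dirder_def using frechet_derivative_works by (auto simp: eta_contract_eq)

lemma dirder_chain:
  assumes "(g has_derivative D) (at x)" and "f differentiable (at (g x))"
  shows "dirder (\<lambda>y. f (g y)) x = (\<lambda>u. dirder f (g x) (D u))"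
  using has_derivative_compose[OF assms(1) has_derivative_dirder[OF assms(2)]] by (rule dirder_eqI)

lemma differentiable_cong_open:
  assumes "open S" "x \<in> S" "\<And>y. y \<in> S \<Longrightarrow> f y = g y" "f differentiable (at x)"
  shows "g differentiable (at x)"
  using assms has_derivative_transform_within_open[of f _ x UNIV S g]
  unfolding differentiable_def by blast

lemma n_smooth_on_Suc:
  "n_smooth_on (Suc n) S f \<longleftrightarrow>
     (\<forall>x\<in>S. f differentiable (at x)) \<and> (\<forall>u. n_smooth_on n S (\<lambda>x. dirder f x u))"
  by (simp add: dirder_def)

lemma n_smooth_on_cong:
  assumes "open S" "\<And>y. y \<in> S \<Longrightarrow> f y = g y" "n_smooth_on n S f"
  shows "n_smooth_on n S g"
  using assms(2,3)
proof (induction n arbitrary: f g)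
  case 0
  then show ?case by (simp cong: continuous_on_cong)
next
  case (Suc n)
  have "n_smooth_on n S (\<lambda>x. dirder g x u)" for u
  proof (rule Suc.IH)
    show "dirder f y u = dirder g y u" if "y \<in> S" for y
      using dirder_cong_open[OF assms(1) that Suc.prems(1)] by simp
    show "n_smooth_on n S (\<lambda>x. dirder f x u)"
      using Suc.prems(2) unfolding n_smooth_on_Suc by blast
  qed
  moreover have "g differentiable (at x)" if "x \<in> S" for x
    using differentiable_cong_open[OF assms(1) that Suc.prems(1)] Suc.prems(2) that by auto
  ultimately show ?case unfolding n_smooth_on_Suc by blast
qed

text \<open>
  The inner map is only allowed to be affine, so that the derivative of the composition is again a
  composition of the same shape and the induction closes without the product rule. This is enough for
  projections of a product to its factors, for the swap of the factors and for slices.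
\<close>

lemma n_smooth_on_compose_affine:
  fixes L :: "'a::real_normed_vector \<Rightarrow> 'b::real_normed_vector"
  assumes "open S'" and L: "bounded_linear L" and "\<And>x. x \<in> S' \<Longrightarrow> c + L x \<in> S"
    and "n_smooth_on n S k"
  shows "n_smooth_on n S' (\<lambda>x. k (c + L x))"
  using assms(4)
proof (induction n arbitrary: k)
  case 0
  then have "continuous_on S k" by simp
  moreover have "continuous_on S' (\<lambda>x. c + L x)"
    using L by (intro continuous_intros) (auto intro: linear_continuous_on)
  ultimately show ?case
    using assms(3) by (auto intro!: continuous_on_compose2[of S k S'])
next
  case (Suc n)
  have A: "((\<lambda>x. c + L x) has_derivative L) (at x)" for x
    using L by (auto intro!: derivative_eq_intros bounded_linear_imp_has_derivative)
  have diff: "k differentiable (at (c + L x))" if "x \<in> S'" for x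
    using Suc.prems assms(3)[OF that] by auto
  have "n_smooth_on n S' (\<lambda>x. dirder (\<lambda>x. k (c + L x)) x u)" for u
  proof (rule n_smooth_on_cong[OF assms(1)])
    show "dirder k (c + L x) (L u) = dirder (\<lambda>x. k (c + L x)) x u" if "x \<in> S'" for x
      using dirder_chain[OF A diff[OF that]] by simp
    show "n_smooth_on n S' (\<lambda>x. dirder k (c + L x) (L u))"
      using Suc.prems unfolding n_smooth_on_Suc
      by (intro Suc.IH[of "\<lambda>z. dirder k z (L u)"]) blast
  qed
  moreover have "(\<lambda>x. k (c + L x)) differentiable (at x)" if "x \<in> S'" for x
    using differentiableI[OF has_derivative_compose[OF A has_derivative_dirder[OF diff[OF that]]]] .
  ultimately show ?case unfolding n_smooth_on_Suc by blast
qed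

lemma n_smooth_on_bounded_linear:
  fixes L :: "'b::real_normed_vector \<Rightarrow> 'c::real_normed_vector"
  assumes "open S" and L: "bounded_linear L" and "n_smooth_on n S k"
  shows "n_smooth_on n S (\<lambda>x. L (k x))"
  using assms(3)
proof (induction n arbitrary: k)
  case 0
  then show ?case using L by (auto intro: bounded_linear.continuous_on)
next
  case (Suc n)
  have der: "((\<lambda>x. L (k x)) has_derivative (\<lambda>u. L (dirder k x u))) (at x)" if "x \<in> S" for x
    using bounded_linear.has_derivative[OF L has_derivative_dirder] Suc.prems that by auto
  have "n_smooth_on n S (\<lambda>x. dirder (\<lambda>x. L (k x)) x u)" for u
  proof (rule n_smooth_on_cong[OF assms(1)])
    show "L (dirder k x u) = dirder (\<lambda>x. L (k x)) x u" if "x \<in> S" for x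
      using dirder_eqI[OF der[OF that]] by simp
    show "n_smooth_on n S (\<lambda>x. L (dirder k x u))"
      using Suc.prems unfolding n_smooth_on_Suc by (intro Suc.IH[of "\<lambda>x. dirder k x u"]) blast
  qed
  then show ?case using der unfolding n_smooth_on_Suc by (blast intro: differentiableI)
qed

lemma n_smooth_on_subset: "n_smooth_on n S f \<Longrightarrow> T \<subseteq> S \<Longrightarrow> n_smooth_on n T f"
  by (induction n arbitrary: f) (auto intro: continuous_on_subset)

lemma smooth_on_subset: "smooth_on S f \<Longrightarrow> T \<subseteq> S \<Longrightarrow> smooth_on T f"
  unfolding smooth_on_def using n_smooth_on_subset by blast

lemma smooth_on_cong:
  "open S \<Longrightarrow> (\<And>y. y \<in> S \<Longrightarrow> f y = g y) \<Longrightarrow> smooth_on S f \<Longrightarrow> smooth_on S g"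
  unfolding smooth_on_def using n_smooth_on_cong by blast

lemma smooth_on_compose_affine:
  assumes "open S'" "bounded_linear L" "\<And>x. x \<in> S' \<Longrightarrow> c + L x \<in> S" "smooth_on S k"
  shows "smooth_on S' (\<lambda>x. k (c + L x))"
  using assms n_smooth_on_compose_affine unfolding smooth_on_def by blast

lemma smooth_on_bounded_linear:
  "open S \<Longrightarrow> bounded_linear L \<Longrightarrow> smooth_on S k \<Longrightarrow> smooth_on S (\<lambda>x. L (k x))"
  unfolding smooth_on_def using n_smooth_on_bounded_linear by blast

lemma smooth_on_imp_differentiable: "smooth_on S f \<Longrightarrow> x \<in> S \<Longrightarrow> f differentiable (at x)"
  unfolding smooth_on_def by (metis n_smooth_on.simps(2))

lemma smooth_on_dirder: "smooth_on S f \<Longrightarrow> smooth_on S (\<lambda>x. dirder f x u)"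
  unfolding smooth_on_def using n_smooth_on_Suc by blast

section \<open>Charts\<close>

lemma chart_props:
  assumes "smooth_atlas A" "(U, \<phi>) \<in> A"
  shows chart_open: "open U" and chart_open_image: "open W \<Longrightarrow> open (\<phi> ` (U \<inter> W))"
    and chart_inj: "inj_on \<phi> U" and chart_continuous: "continuous_on U \<phi>"
proof -
  have "is_chart (U, \<phi>)"
    using assms unfolding smooth_atlas_def by blast
  then have U: "open U" "open (\<phi> ` U)" and hom: "homeomorphism U (\<phi> ` U) \<phi> (inv_into U \<phi>)"
    unfolding is_chart_def by auto
  show "open U" by fact
  show inj: "inj_on \<phi> U"
    using hom unfolding homeomorphism_def by (metis inj_on_inverseI)
  show "continuous_on U \<phi>"
    using hom unfolding homeomorphism_def by blast
  have cont: "continuous_on (\<phi> ` U) (inv_into U \<phi>)"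
    using hom unfolding homeomorphism_def by blast
  assume "open W"
  moreover have "\<phi> ` (U \<inter> W) = \<phi> ` U \<inter> inv_into U \<phi> -` W"
    using inj by auto
  ultimately show "open (\<phi> ` (U \<inter> W))"
    using continuous_open_preimage[OF cont U(2)] by simp
qed

lemma smooth_near_imp_differentiable:
  assumes "smooth_near A p k" "(U, \<phi>) \<in> A" "p \<in> U"
  shows "(k \<circ> inv_into U \<phi>) differentiable (at (\<phi> p))"
proof -
  obtain W where "p \<in> W" "smooth_fun_on A W k"
    using assms(1) unfolding smooth_near_def by blast
  then have "smooth_on (\<phi> ` (U \<inter> W)) (k \<circ> inv_into U \<phi>)" "\<phi> p \<in> \<phi> ` (U \<inter> W)"
    using assms(2,3) unfolding smooth_fun_on_def by auto
  then show ?thesis using smooth_on_imp_differentiable by blast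
qed

text \<open>
  In any other chart this function is a component of a transition map.
\<close>

lemma smooth_near_coordinate:
  assumes "smooth_atlas A" "(U, \<phi>) \<in> A" "p \<in> U"
  shows "smooth_near A p (\<lambda>q. \<phi> q \<bullet> b)"
proof -
  have "smooth_on (\<psi> ` (V \<inter> U)) ((\<lambda>q. \<phi> q \<bullet> b) \<circ> inv_into V \<psi>)" if V: "(V, \<psi>) \<in> A" for V \<psi>
  proof -
    have "smooth_on (\<psi> ` (V \<inter> U)) (\<phi> \<circ> inv_into V \<psi>)"
      using assms(1,2) V unfolding smooth_atlas_def by blast
    then have "smooth_on (\<psi> ` (V \<inter> U)) (\<lambda>x. (\<phi> \<circ> inv_into V \<psi>) x \<bullet> b)"
      using smooth_on_bounded_linear[OF chart_open_image[OF assms(1) V chart_open[OF assms(1,2)]]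
          bounded_linear_inner_left] by blast
    then show ?thesis by (simp add: o_def)
  qed
  then have "smooth_fun_on A U (\<lambda>q. \<phi> q \<bullet> b)"
    unfolding smooth_fun_on_def by blast
  then show ?thesis
    unfolding smooth_near_def using chart_open[OF assms(1,2)] assms(3) by blast
qed

section \<open>Tangent vectors in coordinates\<close>

lemma coord_tvec_apply:
  "coord_tvec A (U, \<phi>) p u k =
     (if smooth_near A p k then dirder (k \<circ> inv_into U \<phi>) (\<phi> p) u else 0)"
  by (simp add: coord_tvec_def dirder_def)

text \<open>
  In the chart \<open>(U, \<phi>)\<close> itself, the coordinate functions of \<open>\<phi>\<close> are the linear functionals
  \<open>x \<mapsto> x \<bullet> b\<close>, whose derivatives read off the coordinates of \<open>u\<close>.
\<close>

lemma components_coord_tvec: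
  assumes "smooth_atlas A" "(U, \<phi>) \<in> A" "p \<in> U"
  shows "components (U, \<phi>) (coord_tvec A (U, \<phi>) p u) = u"
proof -
  have "coord_tvec A (U, \<phi>) p u (\<lambda>q. \<phi> q \<bullet> b) = u \<bullet> b" for b
  proof -
    have "dirder ((\<lambda>q. \<phi> q \<bullet> b) \<circ> inv_into U \<phi>) (\<phi> p) = dirder (\<lambda>x. x \<bullet> b) (\<phi> p)"
      using chart_open_image[OF assms(1,2) open_UNIV] assms(3)
      by (intro dirder_cong_open[where S = "\<phi> ` U"]) (auto simp: f_inv_into_f)
    also have "\<dots> = (\<lambda>u. u \<bullet> b)"
      by (intro dirder_eqI) (auto intro!: derivative_eq_intros)
    finally show ?thesis
      by (simp add: coord_tvec_apply smooth_near_coordinate[OF assms])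
  qed
  then show ?thesis
    by (simp add: components_def euclidean_representation)
qed

lemma coord_tvec_linear:
  assumes "(U, \<phi>) \<in> A" "p \<in> U"
  shows "coord_tvec A (U, \<phi>) p (a *\<^sub>R u + b *\<^sub>R v) =
     (\<lambda>k. a * coord_tvec A (U, \<phi>) p u k + b * coord_tvec A (U, \<phi>) p v k)"
proof
  fix k
  have "linear (dirder (k \<circ> inv_into U \<phi>) (\<phi> p))" if "smooth_near A p k"
    using has_derivative_linear[OF has_derivative_dirder[OF
          smooth_near_imp_differentiable[OF that assms]]] .
  then show "coord_tvec A (U, \<phi>) p (a *\<^sub>R u + b *\<^sub>R v) k =
      a * coord_tvec A (U, \<phi>) p u k + b * coord_tvec A (U, \<phi>) p v k"
    by (simp add: coord_tvec_apply linear_add linear_scale)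
qed

lemma coord_tvec_in_tangent_space:
  "(U, \<phi>) \<in> A \<Longrightarrow> p \<in> U \<Longrightarrow> coord_tvec A (U, \<phi>) p u \<in> tangent_space A p"
  unfolding tangent_space_def by (auto intro!: exI[of _ "U"] exI[of _ \<phi>])

text \<open>
  A tangent vector may be presented in one chart while the Hessian is computed in another. By the
  chain rule the presentation in a chart \<open>\<psi>\<close> turns into one in \<open>\<phi>\<close> when the coordinate vector is
  transformed by the derivative of the transition map.
\<close>

lemma tangent_space_eq_coord_tvec:
  assumes "smooth_atlas A" "(U, \<phi>) \<in> A" "p \<in> U" "v \<in> tangent_space A p"
  obtains u where "v = coord_tvec A (U, \<phi>) p u"
proof -
  obtain V \<psi> w where V: "(V, \<psi>) \<in> A" "p \<in> V" and v: "v = coord_tvec A (V, \<psi>) p w"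
    using assms(4) unfolding tangent_space_def by auto
  define \<tau> where "\<tau> = \<phi> \<circ> inv_into V \<psi>"
  let ?S = "\<psi> ` (V \<inter> U)"
  have inv [simp]: "inv_into V \<psi> (\<psi> q) = q" if "q \<in> V" for q
    using chart_inj[OF assms(1) V(1)] that by simp
  have inv' [simp]: "inv_into U \<phi> (\<phi> q) = q" if "q \<in> U" for q
    using chart_inj[OF assms(1,2)] that by simp
  have "smooth_on ?S \<tau>"
    using assms(1,2) V unfolding smooth_atlas_def \<tau>_def by blast
  then have \<tau>: "(\<tau> has_derivative dirder \<tau> (\<psi> p)) (at (\<psi> p))"
    using has_derivative_dirder smooth_on_imp_differentiable V assms(3) by blast
  have \<tau>p: "\<tau> (\<psi> p) = \<phi> p" using V by (simp add: \<tau>_def)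
  have "coord_tvec A (V, \<psi>) p w k = coord_tvec A (U, \<phi>) p (dirder \<tau> (\<psi> p) w) k" for k
  proof (cases "smooth_near A p k")
    case True
    have "dirder (k \<circ> inv_into V \<psi>) (\<psi> p) = dirder (\<lambda>x. (k \<circ> inv_into U \<phi>) (\<tau> x)) (\<psi> p)"
      using chart_open_image[OF assms(1) V(1) chart_open[OF assms(1,2)]] V(2) assms(3)
      by (intro dirder_cong_open[where S = ?S]) (auto simp: \<tau>_def)
    also have "\<dots> = (\<lambda>w. dirder (k \<circ> inv_into U \<phi>) (\<phi> p) (dirder \<tau> (\<psi> p) w))"
      using dirder_chain[OF \<tau>, of "k \<circ> inv_into U \<phi>"]
        smooth_near_imp_differentiable[OF True assms(2,3)]
      unfolding \<tau>p by blast
    finally show ?thesis by (simp add: coord_tvec_apply True)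
  qed (simp add: coord_tvec_apply)
  then show thesis using that v by blast
qed

section \<open>Product charts\<close>

lemma inv_into_map_prod:
  assumes "inj_on \<phi> U" "inj_on \<psi> V" "x \<in> \<phi> ` U" "y \<in> \<psi> ` V"
  shows "inv_into (U \<times> V) (map_prod \<phi> \<psi>) (x, y) = (inv_into U \<phi> x, inv_into V \<psi> y)"
proof (rule inv_into_f_eq)
  show "inj_on (map_prod \<phi> \<psi>) (U \<times> V)"
    using assms(1,2) by (simp add: map_prod_inj_on)
qed (use assms in \<open>auto simp: inv_into_into f_inv_into_f\<close>)

lemma atlas_cover:
  assumes "smooth_atlas A"
  obtains U \<phi> where "(U, \<phi>) \<in> A" "p \<in> U"
proof -
  have "p \<in> (\<Union>\<kappa>\<in>A. fst \<kappa>)"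
    using assms unfolding smooth_atlas_def by simp
  then show thesis using that by force
qed

text \<open>
  A tangent vector is 0 on functions that are not smooth near the point, so pushing tangent vectors forward
  requires both directions: composing with the projection must neither destroy nor create smoothness.
  For the second, \<open>k\<close> is recovered from \<open>k \<circ> fst\<close> on a slice with constant fibre coordinate.
\<close>

lemma smooth_near_fst_iff:
  assumes B: "smooth_atlas AB" and F: "smooth_atlas AF"
  shows "smooth_near (product_atlas AB AF) (p, q) (k \<circ> fst) \<longleftrightarrow> smooth_near AB p k"
proof
  assume "smooth_near AB p k"
  then obtain W where W: "open W" "p \<in> W" "smooth_fun_on AB W k"
    unfolding smooth_near_def by blast
  have "smooth_on (map_prod \<phi> \<psi> ` ((U \<times> V) \<inter> W \<times> UNIV))
          (k \<circ> fst \<circ> inv_into (U \<times> V) (map_prod \<phi> \<psi>))"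
    if U: "(U, \<phi>) \<in> AB" and V: "(V, \<psi>) \<in> AF" for U \<phi> V \<psi>
  proof -
    have im: "map_prod \<phi> \<psi> ` ((U \<times> V) \<inter> W \<times> UNIV) = \<phi> ` (U \<inter> W) \<times> \<psi> ` V" (is "_ = ?S")
      by auto
    have k: "smooth_on (\<phi> ` (U \<inter> W)) (k \<circ> inv_into U \<phi>)"
      using W(3) U unfolding smooth_fun_on_def by blast
    have "open ?S"
      using chart_open_image[OF B U W(1)] chart_open_image[OF F V open_UNIV] by (simp add: open_Times)
    have "smooth_on ?S (\<lambda>x. (k \<circ> inv_into U \<phi>) (0 + fst x))"
      by (rule smooth_on_compose_affine[OF \<open>open ?S\<close> bounded_linear_fst _ k]) auto
    then show ?thesis unfolding im
      by (rule smooth_on_cong[OF \<open>open ?S\<close>, rotated])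
        (auto simp: inv_into_map_prod[OF chart_inj[OF B U] chart_inj[OF F V]])
  qed
  then have "smooth_fun_on (product_atlas AB AF) (W \<times> UNIV) (k \<circ> fst)"
    unfolding smooth_fun_on_def product_atlas_def by auto
  then show "smooth_near (product_atlas AB AF) (p, q) (k \<circ> fst)"
    unfolding smooth_near_def using W by (intro exI[of _ "W \<times> UNIV"]) (simp add: open_Times)
next
  assume "smooth_near (product_atlas AB AF) (p, q) (k \<circ> fst)"
  then obtain W' where "open W'" "(p, q) \<in> W'" "smooth_fun_on (product_atlas AB AF) W' (k \<circ> fst)"
    unfolding smooth_near_def by blast
  moreover obtain W Z where W: "open W" "p \<in> W" and Z: "open Z" "q \<in> Z" and "W \<times> Z \<subseteq> W'"
    using \<open>open W'\<close> \<open>(p, q) \<in> W'\<close> unfolding open_prod_def by (metis mem_Sigma_iff)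
  ultimately have W': "smooth_fun_on (product_atlas AB AF) W' (k \<circ> fst)" "W \<times> Z \<subseteq> W'" by auto
  obtain V \<psi> where V: "(V, \<psi>) \<in> AF" "q \<in> V" using atlas_cover[OF F] .
  have "smooth_on (\<phi> ` (U \<inter> W)) (k \<circ> inv_into U \<phi>)" if U: "(U, \<phi>) \<in> AB" for U \<phi>
  proof -
    let ?K = "k \<circ> fst \<circ> inv_into (U \<times> V) (map_prod \<phi> \<psi>)"
    have "(U \<times> V, map_prod \<phi> \<psi>) \<in> product_atlas AB AF"
      using U V unfolding product_atlas_def by blast
    then have "smooth_on (map_prod \<phi> \<psi> ` ((U \<times> V) \<inter> W')) ?K"
      using W'(1) unfolding smooth_fun_on_def by blast
    then have K: "smooth_on (map_prod \<phi> \<psi> ` ((U \<times> V) \<inter> W \<times> Z)) ?K"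
      by (rule smooth_on_subset) (use W'(2) in auto)
    have S: "open (\<phi> ` (U \<inter> W))" using chart_open_image[OF B U W(1)] .
    have "smooth_on (\<phi> ` (U \<inter> W)) (\<lambda>x. ?K ((0, \<psi> q) + (x, 0)))"
    proof (rule smooth_on_compose_affine[OF S _ _ K])
      show "bounded_linear (\<lambda>x::'b. (x, 0::'d))"
        by (intro bounded_linear_Pair bounded_linear_ident bounded_linear_zero)
      show "(0, \<psi> q) + (x, 0) \<in> map_prod \<phi> \<psi> ` ((U \<times> V) \<inter> W \<times> Z)" if x: "x \<in> \<phi> ` (U \<inter> W)" for x
      proof -
        obtain p' where "x = \<phi> p'" "p' \<in> U \<inter> W"
          using x by blast
        then show ?thesis
          using V(2) Z(2) by (intro image_eqI[of _ _ "(p', q)"]) auto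
      qed
    qed
    then show ?thesis
    proof (rule smooth_on_cong[OF S, rotated])
      show "?K ((0, \<psi> q) + (x, 0)) = (k \<circ> inv_into U \<phi>) x" if "x \<in> \<phi> ` (U \<inter> W)" for x
      proof -
        have "x \<in> \<phi> ` U" "\<psi> q \<in> \<psi> ` V" using that V(2) by auto
        from inv_into_map_prod[OF chart_inj[OF B U] chart_inj[OF F V(1)] this]
        show ?thesis by simp
      qed
    qed
  qed
  then show "smooth_near AB p k"
    unfolding smooth_near_def smooth_fun_on_def using W by (intro exI[of _ W] conjI ballI) auto
qed

text \<open>
  By this symmetry of product atlases, the equivalence for the first projection yields the one for the second.
\<close>

lemma smooth_near_swap:
  assumes B: "smooth_atlas AB" and F: "smooth_atlas AF"
    and "smooth_near (product_atlas AB AF) (p, q) k"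
  shows "smooth_near (product_atlas AF AB) (q, p) (k \<circ> prod.swap)"
proof -
  obtain W where W: "open W" "(p, q) \<in> W" "smooth_fun_on (product_atlas AB AF) W k"
    using assms(3) unfolding smooth_near_def by blast
  let ?W = "prod.swap -` W"
  have "open ?W"
    by (rule open_vimage[OF W(1)]) (auto intro!: continuous_intros simp: prod.swap_def)
  moreover have "smooth_on (map_prod \<psi> \<phi> ` ((V \<times> U) \<inter> ?W))
      (k \<circ> prod.swap \<circ> inv_into (V \<times> U) (map_prod \<psi> \<phi>))"
    if U: "(U, \<phi>) \<in> AB" and V: "(V, \<psi>) \<in> AF" for U \<phi> V \<psi>
  proof -
    have inj: "inj_on \<phi> U" "inj_on \<psi> V"
      using chart_inj[OF B U] chart_inj[OF F V] by auto
    let ?S = "map_prod \<psi> \<phi> ` ((V \<times> U) \<inter> ?W)"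
    let ?K = "k \<circ> inv_into (U \<times> V) (map_prod \<phi> \<psi>)"
    have "(U \<times> V, map_prod \<phi> \<psi>) \<in> product_atlas AB AF"
      using U V unfolding product_atlas_def by blast
    then have K: "smooth_on (map_prod \<phi> \<psi> ` ((U \<times> V) \<inter> W)) ?K"
      using W(3) unfolding smooth_fun_on_def by blast
    have "open ?S"
      unfolding open_subopen[of ?S]
    proof
      fix z assume "z \<in> ?S"
      then obtain q' p' where z: "z = (\<psi> q', \<phi> p')" "q' \<in> V" "p' \<in> U" "(p', q') \<in> W"
        by auto
      then obtain W1 W2 where W12: "open W1" "open W2" "p' \<in> W1" "q' \<in> W2" "W1 \<times> W2 \<subseteq> W"
        using W(1) unfolding open_prod_def by (metis mem_Sigma_iff)
      have "open (\<psi> ` (V \<inter> W2) \<times> \<phi> ` (U \<inter> W1))"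
        using chart_open_image[OF B U W12(1)] chart_open_image[OF F V W12(2)] by (rule open_Times[rotated])
      moreover have "\<psi> ` (V \<inter> W2) \<times> \<phi> ` (U \<inter> W1) \<subseteq> ?S"
      proof
        fix z assume "z \<in> \<psi> ` (V \<inter> W2) \<times> \<phi> ` (U \<inter> W1)"
        then obtain q' p' where "z = (\<psi> q', \<phi> p')" "q' \<in> V \<inter> W2" "p' \<in> U \<inter> W1"
          by blast
        then show "z \<in> ?S"
          using W12(5) by (intro image_eqI[of _ _ "(q', p')"]) auto
      qed
      ultimately show "\<exists>T. open T \<and> z \<in> T \<and> T \<subseteq> ?S"
        using z W12 by (intro exI[of _ "\<psi> ` (V \<inter> W2) \<times> \<phi> ` (U \<inter> W1)"]) auto
    qed
    have "smooth_on ?S (\<lambda>x. ?K (0 + prod.swap x))"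
      by (rule smooth_on_compose_affine[OF \<open>open ?S\<close> _ _ K])
        (auto simp: prod.swap_def intro!: bounded_linear_Pair bounded_linear_fst bounded_linear_snd)
    then show ?thesis
      by (rule smooth_on_cong[OF \<open>open ?S\<close>, rotated]) (auto simp: inv_into_map_prod inj)
  qed
  ultimately have "smooth_fun_on (product_atlas AF AB) ?W (k \<circ> prod.swap)"
    unfolding smooth_fun_on_def product_atlas_def by auto
  then show ?thesis
    unfolding smooth_near_def using \<open>open ?W\<close> W(2) by (intro exI[of _ ?W]) auto
qed

lemma smooth_near_snd_iff:
  assumes B: "smooth_atlas AB" and F: "smooth_atlas AF"
  shows "smooth_near (product_atlas AB AF) (p, q) (k \<circ> snd) \<longleftrightarrow> smooth_near AF q k"
proof -
  have "(k \<circ> snd) \<circ> prod.swap = k \<circ> fst" "(k \<circ> fst) \<circ> prod.swap = k \<circ> snd"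
    by auto
  then have "smooth_near (product_atlas AB AF) (p, q) (k \<circ> snd) \<longleftrightarrow>
      smooth_near (product_atlas AF AB) (q, p) (k \<circ> fst)"
    using smooth_near_swap[OF B F, of p q "k \<circ> snd"] smooth_near_swap[OF F B, of q p "k \<circ> fst"]
    by metis
  then show ?thesis using smooth_near_fst_iff[OF F B] by blast
qed

lemma push_forward_coord_tvec:
  assumes B: "smooth_atlas AB" and F: "smooth_atlas AF"
    and U: "(U, \<phi>) \<in> AB" "p \<in> U" and V: "(V, \<psi>) \<in> AF" "q \<in> V"
  shows push_forward_fst_coord_tvec:
      "push_forward fst (coord_tvec (product_atlas AB AF) (U \<times> V, map_prod \<phi> \<psi>) (p, q) u) =
       coord_tvec AB (U, \<phi>) p (fst u)"
    and push_forward_snd_coord_tvec: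
      "push_forward snd (coord_tvec (product_atlas AB AF) (U \<times> V, map_prod \<phi> \<psi>) (p, q) u) =
       coord_tvec AF (V, \<psi>) q (snd u)"
proof -
  note inv = inv_into_map_prod[OF chart_inj[OF B U(1)] chart_inj[OF F V(1)]]
  have op: "open (\<phi> ` U \<times> \<psi> ` V)"
    using chart_open_image[OF B U(1) open_UNIV] chart_open_image[OF F V(1) open_UNIV]
    by (simp add: open_Times)
  have 1: "dirder (k \<circ> fst \<circ> inv_into (U \<times> V) (map_prod \<phi> \<psi>)) (\<phi> p, \<psi> q) u =
      dirder (k \<circ> inv_into U \<phi>) (\<phi> p) (fst u)" if k: "smooth_near AB p k" for k
  proof -
    have "dirder (k \<circ> fst \<circ> inv_into (U \<times> V) (map_prod \<phi> \<psi>)) (\<phi> p, \<psi> q) =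
        dirder (\<lambda>z. (k \<circ> inv_into U \<phi>) (fst z)) (\<phi> p, \<psi> q)"
      using U V by (intro dirder_cong_open[OF op]) (auto simp: inv)
    also have "\<dots> = (\<lambda>u. dirder (k \<circ> inv_into U \<phi>) (fst (\<phi> p, \<psi> q)) (fst u))"
      using smooth_near_imp_differentiable[OF k U]
      by (intro dirder_chain) (auto intro!: derivative_eq_intros simp: o_def)
    finally show ?thesis by simp
  qed
  have 2: "dirder (k \<circ> snd \<circ> inv_into (U \<times> V) (map_prod \<phi> \<psi>)) (\<phi> p, \<psi> q) u =
      dirder (k \<circ> inv_into V \<psi>) (\<psi> q) (snd u)" if k: "smooth_near AF q k" for k
  proof -
    have "dirder (k \<circ> snd \<circ> inv_into (U \<times> V) (map_prod \<phi> \<psi>)) (\<phi> p, \<psi> q) =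
        dirder (\<lambda>z. (k \<circ> inv_into V \<psi>) (snd z)) (\<phi> p, \<psi> q)"
      using U V by (intro dirder_cong_open[OF op]) (auto simp: inv)
    also have "\<dots> = (\<lambda>u. dirder (k \<circ> inv_into V \<psi>) (snd (\<phi> p, \<psi> q)) (snd u))"
      using smooth_near_imp_differentiable[OF k V]
      by (intro dirder_chain) (auto intro!: derivative_eq_intros simp: o_def)
    finally show ?thesis by simp
  qed
  show "push_forward fst (coord_tvec (product_atlas AB AF) (U \<times> V, map_prod \<phi> \<psi>) (p, q) u) =
       coord_tvec AB (U, \<phi>) p (fst u)"
    by (rule ext) (simp add: push_forward_def coord_tvec_apply smooth_near_fst_iff[OF B F] 1)
  show "push_forward snd (coord_tvec (product_atlas AB AF) (U \<times> V, map_prod \<phi> \<psi>) (p, q) u) =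
       coord_tvec AF (V, \<psi>) q (snd u)"
    by (rule ext) (simp add: push_forward_def coord_tvec_apply smooth_near_snd_iff[OF B F] 2)
qed

text \<open>
  The coordinate functions of a product chart are those of the factors composed with the
  projections.
\<close>

lemma components_map_prod:
  "components (U \<times> V, map_prod \<phi> \<psi>) v =
     (components (U, \<phi>) (push_forward fst v), components (V, \<psi>) (push_forward snd v))"
proof -
  have "(\<Sum>b\<in>(\<lambda>u. (u, 0)) ` Basis. v (\<lambda>q. map_prod \<phi> \<psi> q \<bullet> b) *\<^sub>R b) =
      (components (U, \<phi>) (push_forward fst v), 0)"
    by (subst sum.reindex)
      (auto simp: inj_on_def components_def push_forward_def o_def inner_prod_def prod_eq_iff
        fst_sum snd_sum)
  moreover have "(\<Sum>b\<in>(\<lambda>u. (0, u)) ` Basis. v (\<lambda>q. map_prod \<phi> \<psi> q \<bullet> b) *\<^sub>R b) =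
      (0, components (V, \<psi>) (push_forward snd v))"
    by (subst sum.reindex)
      (auto simp: inj_on_def components_def push_forward_def o_def inner_prod_def prod_eq_iff
        fst_sum snd_sum)
  moreover have "components (U \<times> V, map_prod \<phi> \<psi>) v =
      (\<Sum>b\<in>(\<lambda>u. (u, 0)) ` Basis. v (\<lambda>q. map_prod \<phi> \<psi> q \<bullet> b) *\<^sub>R b) +
      (\<Sum>b\<in>(\<lambda>u. (0, u)) ` Basis. v (\<lambda>q. map_prod \<phi> \<psi> q \<bullet> b) *\<^sub>R b)"
    unfolding components_def Basis_prod_def snd_conv
    by (rule sum.union_disjoint) auto
  ultimately show ?thesis by simp
qed

lemma local_metric_warped:
  assumes B: "smooth_atlas AB" and F: "smooth_atlas AF"
    and U: "(U, \<phi>) \<in> AB" "x \<in> \<phi> ` U" and V: "(V, \<psi>) \<in> AF" "y \<in> \<psi> ` V"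
  shows "local_metric (product_atlas AB AF) (U \<times> V, map_prod \<phi> \<psi>) (warped_metric gB f gF) (x, y) u v
     = local_metric AB (U, \<phi>) gB x (fst u) (fst v)
       + ((f \<circ> inv_into U \<phi>) x)\<^sup>2 * local_metric AF (V, \<psi>) gF y (snd u) (snd v)"
  using push_forward_coord_tvec[OF B F U(1) inv_into_into[OF U(2)] V(1) inv_into_into[OF V(2)]]
  by (simp add: local_metric_def Let_def warped_metric_def
      inv_into_map_prod[OF chart_inj[OF B U(1)] chart_inj[OF F V(1)] U(2) V(2)])

section \<open>Metrics in coordinates\<close>

lemma linear_functional_eq_inner:
  fixes \<alpha> :: "'e::euclidean_space \<Rightarrow> real"
  assumes "linear \<alpha>"
  shows "\<alpha> w = (\<Sum>b\<in>Basis. \<alpha> b *\<^sub>R b) \<bullet> w"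
proof -
  have "\<alpha> w = \<alpha> (\<Sum>b\<in>Basis. (w \<bullet> b) *\<^sub>R b)"
    by (simp add: euclidean_representation)
  also have "\<dots> = (\<Sum>b\<in>Basis. (w \<bullet> b) * \<alpha> b)"
    by (simp only: linear_sum[OF assms] linear_scale[OF assms] real_scaleR_def)
  finally show ?thesis
    by (simp add: inner_sum_left inner_commute[of w] mult.commute)
qed

lemma sharp_eqI:
  assumes "bilinear (G x)" and nondeg: "\<And>z. (\<And>w. G x z w = 0) \<Longrightarrow> z = 0"
    and "\<And>w. G x z w = \<alpha> w"
  shows "sharp G x \<alpha> = z"
  unfolding sharp_def
proof (rule the_equality)
  fix z' assume "\<forall>w. G x z' w = \<alpha> w"
  then have "G x (z' - z) w = 0" for w
    using assms(3) bilinear_lsub[OF assms(1)] by simp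
  then show "z' = z" using nondeg[of "z' - z"] by simp
qed (use assms(3) in simp)

definition koszul ::
  "('e::euclidean_space \<Rightarrow> 'e \<Rightarrow> 'e \<Rightarrow> real) \<Rightarrow> 'e \<Rightarrow> 'e \<Rightarrow> 'e \<Rightarrow> 'e \<Rightarrow> real" where
  "koszul G x u v w =
     (dirder (\<lambda>y. G y v w) x u + dirder (\<lambda>y. G y u w) x v - dirder (\<lambda>y. G y u v) x w) / 2"

lemma christoffel_eq_sharp_koszul: "christoffel G x u v = sharp G x (koszul G x u v)"
  by (simp add: christoffel_def koszul_def[abs_def])

locale coordinate_metric =
  fixes S :: "'e::euclidean_space set" and G :: "'e \<Rightarrow> 'e \<Rightarrow> 'e \<Rightarrow> real"
  assumes open_S: "open S"
    and bilinear: "x \<in> S \<Longrightarrow> bilinear (G x)"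
    and nondegenerate: "x \<in> S \<Longrightarrow> (\<And>w. G x z w = 0) \<Longrightarrow> z = 0"
    and differentiable: "x \<in> S \<Longrightarrow> (\<lambda>y. G y u v) differentiable (at x)"
begin

text \<open>
  Raising an index is possible in finite dimension: the linear map that represents \<open>G x\<close> through the
  Euclidean inner product is injective by nondegeneracy, hence surjective.
\<close>

lemma sharp_works:
  assumes x: "x \<in> S" and "linear \<alpha>"
  shows "G x (sharp G x \<alpha>) w = \<alpha> w"
proof -
  define T where "T z = (\<Sum>b\<in>Basis. G x z b *\<^sub>R b)" for z
  have T: "T z \<bullet> w = G x z w" for z w
  proof -
    have lin: "linear (G x z)" using bilinear[OF x] unfolding bilinear_def by blast
    show ?thesis unfolding T_def by (rule linear_functional_eq_inner[OF lin, symmetric])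
  qed
  have "linear T"
    unfolding T_def
    by (rule linearI)
      (simp_all add: bilinear_ladd[OF bilinear[OF x]] bilinear_lmul[OF bilinear[OF x]]
        scaleR_left_distrib sum.distrib scaleR_sum_right)
  moreover have "inj T"
    unfolding linear_injective_0[OF \<open>linear T\<close>]
  proof (intro allI impI)
    fix z assume "T z = 0"
    then have "G x z w = 0" for w using T[of z w] by simp
    then show "z = 0" by (rule nondegenerate[OF x])
  qed
  ultimately have "surj T" using \<open>linear T\<close> by (intro linear_inj_imp_surj)
  then obtain z where z: "(\<Sum>b\<in>Basis. \<alpha> b *\<^sub>R b) = T z" by (rule surjE)
  have "G x z w = \<alpha> w" for w
    using T[of z w] linear_functional_eq_inner[OF \<open>linear \<alpha>\<close>, of w] by (simp only: z)
  moreover from this have "sharp G x \<alpha> = z"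
    using sharp_eqI[of G x z \<alpha>] bilinear[OF x] nondegenerate[OF x] by blast
  ultimately show ?thesis by simp
qed

lemma has_derivative_metric:
  assumes "x \<in> S"
  shows "((\<lambda>y. G y u v) has_derivative dirder (\<lambda>y. G y u v) x) (at x)"
  using has_derivative_dirder[OF differentiable[OF assms]] .

lemma linear_koszul:
  assumes x: "x \<in> S"
  shows "linear (koszul G x u v)"
proof -
  have add: "dirder (\<lambda>y. G y u (v + w)) x = (\<lambda>z. dirder (\<lambda>y. G y u v) x z + dirder (\<lambda>y. G y u w) x z)"
    for u v w
  proof -
    have "dirder (\<lambda>y. G y u (v + w)) x = dirder (\<lambda>y. G y u v + G y u w) x"
      by (rule dirder_cong_open[OF open_S x]) (simp add: bilinear_radd[OF bilinear])
    also have "\<dots> = (\<lambda>z. dirder (\<lambda>y. G y u v) x z + dirder (\<lambda>y. G y u w) x z)"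
      by (intro dirder_eqI has_derivative_add has_derivative_metric x)
    finally show ?thesis .
  qed
  have scale: "dirder (\<lambda>y. G y u (c *\<^sub>R v)) x = (\<lambda>z. c * dirder (\<lambda>y. G y u v) x z)" for u v c
  proof -
    have "dirder (\<lambda>y. G y u (c *\<^sub>R v)) x = dirder (\<lambda>y. c * G y u v) x"
      by (rule dirder_cong_open[OF open_S x]) (simp add: bilinear_rmul[OF bilinear])
    also have "\<dots> = (\<lambda>z. c * dirder (\<lambda>y. G y u v) x z)"
      by (intro dirder_eqI has_derivative_mult_right has_derivative_metric x)
    finally show ?thesis .
  qed
  have lin: "linear (dirder (\<lambda>y. G y u v) x)"
    using has_derivative_linear[OF has_derivative_metric[OF x]] .
  show ?thesis
    by (rule linearI)
      (simp_all add: koszul_def add scale linear_add[OF lin] linear_scale[OF lin] field_simps)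
qed

lemma metric_christoffel: "x \<in> S \<Longrightarrow> G x (christoffel G x u v) w = koszul G x u v w"
  unfolding christoffel_eq_sharp_koszul by (rule sharp_works[OF _ linear_koszul])

end

section \<open>Warped products in coordinates\<close>

locale warped_coordinates = base: coordinate_metric S GB + fibre: coordinate_metric T GF
  for S :: "'e::euclidean_space set" and GB and T :: "'d::euclidean_space set" and GF +
  fixes F :: "'e \<Rightarrow> real" and G :: "'e \<times> 'd \<Rightarrow> 'e \<times> 'd \<Rightarrow> 'e \<times> 'd \<Rightarrow> real"
  assumes F_nonzero: "x \<in> S \<Longrightarrow> F x \<noteq> 0"
    and F_differentiable: "x \<in> S \<Longrightarrow> F differentiable (at x)"
    and warped: "x \<in> S \<Longrightarrow> y \<in> T \<Longrightarrow>
      G (x, y) u v = GB x (fst u) (fst v) + (F x)\<^sup>2 * GF y (snd u) (snd v)"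
begin

lemma open_ST: "open (S \<times> T)"
  using base.open_S fibre.open_S by (rule open_Times)

text \<open>
  A product of nondegenerate forms, the second one scaled by \<open>(F x)\<^sup>2 \<noteq> 0\<close>, is nondegenerate; hence
  every solution of the equation that defines \<open>sharp\<close> is its value.
\<close>

lemma sharp_warped_eqI:
  assumes x: "x \<in> S" and y: "y \<in> T"
    and eq: "\<And>w. GB x (fst z) (fst w) + (F x)\<^sup>2 * GF y (snd z) (snd w) = \<alpha> w"
  shows "sharp G (x, y) \<alpha> = z"
proof (rule sharp_eqI)
  note B = base.bilinear[OF x] and F = fibre.bilinear[OF y]
  show "bilinear (G (x, y))"
    unfolding bilinear_def
    by (intro conjI allI linearI)
      (simp_all add: warped[OF x y] bilinear_ladd[OF B] bilinear_radd[OF B] bilinear_lmul[OF B]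
        bilinear_rmul[OF B] bilinear_ladd[OF F] bilinear_radd[OF F] bilinear_lmul[OF F]
        bilinear_rmul[OF F] algebra_simps)
  show "G (x, y) z w = \<alpha> w" for w using eq by (simp add: warped[OF x y])
  fix z assume z: "\<And>w. G (x, y) z w = 0"
  have "GB x (fst z) w = 0" for w
    using z[of "(w, 0)"] by (simp add: warped[OF x y] bilinear_rzero[OF F])
  moreover have "GF y (snd z) w = 0" for w
    using z[of "(0, w)"] F_nonzero[OF x] by (simp add: warped[OF x y] bilinear_rzero[OF B])
  ultimately have "fst z = 0" "snd z = 0"
    using base.nondegenerate[OF x] fibre.nondegenerate[OF y] by blast+
  then show "z = 0" by (simp add: prod_eq_iff)
qed

lemma dirder_warped:
  assumes x: "x \<in> S" and y: "y \<in> T"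
  shows "dirder (\<lambda>z. G z u v) (x, y) w =
     dirder (\<lambda>x. GB x (fst u) (fst v)) x (fst w)
     + 2 * F x * dirder F x (fst w) * GF y (snd u) (snd v)
     + (F x)\<^sup>2 * dirder (\<lambda>y. GF y (snd u) (snd v)) y (snd w)"
proof -
  have "dirder (\<lambda>z. G z u v) (x, y) =
      dirder (\<lambda>z. GB (fst z) (fst u) (fst v) + (F (fst z))\<^sup>2 * GF (snd z) (snd u) (snd v)) (x, y)"
    using x y by (intro dirder_cong_open[OF open_ST]) (auto simp: warped)
  also have "\<dots> = (\<lambda>w. dirder (\<lambda>x. GB x (fst u) (fst v)) x (fst w)
     + 2 * F x * dirder F x (fst w) * GF y (snd u) (snd v)
     + (F x)\<^sup>2 * dirder (\<lambda>y. GF y (snd u) (snd v)) y (snd w))"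
  proof (rule dirder_eqI)
    have "((\<lambda>z::'e\<times>'d. GB (fst z) (fst u) (fst v)) has_derivative
        (\<lambda>w. dirder (\<lambda>x. GB x (fst u) (fst v)) x (fst w))) (at (x, y))"
      by (rule has_derivative_compose[where f = fst])
        (use base.has_derivative_metric[OF x] in \<open>auto intro!: derivative_eq_intros\<close>)
    moreover have "((\<lambda>z::'e\<times>'d. GF (snd z) (snd u) (snd v)) has_derivative
        (\<lambda>w. dirder (\<lambda>y. GF y (snd u) (snd v)) y (snd w))) (at (x, y))"
      by (rule has_derivative_compose[where f = snd])
        (use fibre.has_derivative_metric[OF y] in \<open>auto intro!: derivative_eq_intros\<close>)
    moreover have "((\<lambda>z::'e\<times>'d. F (fst z)) has_derivative (\<lambda>w. dirder F x (fst w))) (at (x, y))"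
      by (rule has_derivative_compose[where f = fst])
        (use has_derivative_dirder[OF F_differentiable[OF x]] in \<open>auto intro!: derivative_eq_intros\<close>)
    ultimately show "((\<lambda>z. GB (fst z) (fst u) (fst v) + (F (fst z))\<^sup>2 * GF (snd z) (snd u) (snd v))
        has_derivative (\<lambda>w. dirder (\<lambda>x. GB x (fst u) (fst v)) x (fst w)
          + 2 * F x * dirder F x (fst w) * GF y (snd u) (snd v)
          + (F x)\<^sup>2 * dirder (\<lambda>y. GF y (snd u) (snd v)) y (snd w))) (at (x, y))"
      by (auto intro!: derivative_eq_intros simp: algebra_simps)
  qed
  finally show ?thesis by simp
qed

text \<open>
  The base is totally geodesic: on horizontal vectors the warped metric is \<open>GB\<close>, which does not
  change along the fibre, and it has no mixed part.
\<close>

lemma christoffel_horizontal: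
  assumes x: "x \<in> S" and y: "y \<in> T"
  shows "christoffel G (x, y) (u, 0) (v, 0) = (christoffel GB x u v, 0)"
  unfolding christoffel_eq_sharp_koszul[of G]
proof (rule sharp_warped_eqI[OF x y])
  have "GF y 0 w = 0" "GF y w 0 = 0" if "y \<in> T" for y w
    using bilinear_lzero[OF fibre.bilinear[OF that]] bilinear_rzero[OF fibre.bilinear[OF that]]
    by auto
  moreover from this have "dirder (\<lambda>y. GF y 0 w) y = (\<lambda>_. 0)" for w
    using y by (subst dirder_cong_open[OF fibre.open_S y, of _ "\<lambda>_. 0"]) (auto intro!: dirder_eqI)
  ultimately show "GB x (fst (christoffel GB x u v, 0)) (fst w)
      + (F x)\<^sup>2 * GF y (snd (christoffel GB x u v, 0)) (snd w) = koszul G (x, y) (u, 0) (v, 0) w" for w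
    using y by (simp add: base.metric_christoffel[OF x] koszul_def dirder_warped[OF x y])
qed

text \<open>
  The classical formula \<open>\<nabla>\<^sub>X V = (X f / f) V\<close> for horizontal \<open>X\<close> and vertical \<open>V\<close>. The only
  surviving term of the Koszul formula is \<open>X (f\<^sup>2) / 2 = f (X f)\<close> times the fibre metric, and lowering
  the index of the right-hand side contributes a factor \<open>f\<^sup>2\<close>.
\<close>

lemma christoffel_mixed:
  assumes x: "x \<in> S" and y: "y \<in> T"
  shows "christoffel G (x, y) (u, 0) (0, v) = (0, (dirder F x u / F x) *\<^sub>R v)"
  unfolding christoffel_eq_sharp_koszul[of G]
proof (rule sharp_warped_eqI[OF x y])
  have F0: "GF y 0 w = 0" "GF y w 0 = 0" if "y \<in> T" for y w
    using bilinear_lzero[OF fibre.bilinear[OF that]] bilinear_rzero[OF fibre.bilinear[OF that]]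
    by auto
  have B0: "GB x 0 w = 0" "GB x w 0 = 0" if "x \<in> S" for x w
    using bilinear_lzero[OF base.bilinear[OF that]] bilinear_rzero[OF base.bilinear[OF that]]
    by auto
  have "dirder (\<lambda>y. GF y 0 w) y = (\<lambda>_. 0)" "dirder (\<lambda>y. GF y w 0) y = (\<lambda>_. 0)" for w
    using F0 y by (subst dirder_cong_open[OF fibre.open_S y, of _ "\<lambda>_. 0"]; auto intro!: dirder_eqI)+
  moreover have "dirder (\<lambda>x. GB x 0 w) x = (\<lambda>_. 0)" "dirder (\<lambda>x. GB x w 0) x = (\<lambda>_. 0)" for w
    using B0 x by (subst dirder_cong_open[OF base.open_S x, of _ "\<lambda>_. 0"]; auto intro!: dirder_eqI)+
  moreover have "linear (dirder F x)"
    using has_derivative_linear[OF has_derivative_dirder[OF F_differentiable[OF x]]] .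
  moreover have "linear (dirder (\<lambda>y. GF y v w) y)" for v w
    using has_derivative_linear[OF fibre.has_derivative_metric[OF y]] .
  moreover have "linear (dirder (\<lambda>x. GB x v w) x)" for v w
    using has_derivative_linear[OF base.has_derivative_metric[OF x]] .
  ultimately show "GB x (fst (0::'e, (dirder F x u / F x) *\<^sub>R v)) (fst w)
      + (F x)\<^sup>2 * GF y (snd (0::'e, (dirder F x u / F x) *\<^sub>R v)) (snd w)
      = koszul G (x, y) (u, 0) (0, v) w" for w
    using x y F_nonzero[OF x]
    by (simp add: koszul_def dirder_warped[OF x y] F0 B0 linear_0 power2_eq_square
        bilinear_lmul[OF fibre.bilinear[OF y]])
qed

end

section \<open>Hessians of functions on a warped product\<close>

lemma dirder_slice_fst:
  assumes "H differentiable (at (x, y))"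
  shows "dirder (\<lambda>x. H (x, y)) x u = dirder H (x, y) (u, 0)"
proof -
  have "((\<lambda>x. (x, y)) has_derivative (\<lambda>u. (u, 0))) (at x)"
    by (auto intro!: derivative_eq_intros)
  from dirder_chain[OF this, of H] assms show ?thesis by simp
qed

lemma smooth_on_slice:
  assumes "open S" "y \<in> T" "smooth_on (S \<times> T) H"
  shows "smooth_on S (\<lambda>x. H (x, y))"
  using smooth_on_compose_affine[OF assms(1) _ _ assms(3), of "\<lambda>x. (x, 0)" "(0, y)"] assms(2)
  by (simp add: bounded_linear_Pair bounded_linear_ident bounded_linear_zero)

lemma local_hessian_cong_open:
  assumes "open S" "x \<in> S" and eq: "\<And>y. y \<in> S \<Longrightarrow> h y = h' y"
  shows "local_hessian G h x u v = local_hessian G h' x u v"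
proof -
  have d: "dirder h y = dirder h' y" if "y \<in> S" for y
    using dirder_cong_open[OF assms(1) that eq] .
  then have "dirder (\<lambda>y. dirder h y v) x = dirder (\<lambda>y. dirder h' y v) x"
    by (intro dirder_cong_open[OF assms(1,2)]) simp
  then show ?thesis using d[OF assms(2)] by (simp add: local_hessian_def)
qed

lemma dirder_scaled_add:
  fixes k k' :: "'e::real_normed_vector \<Rightarrow> real"
  assumes "k differentiable (at x)" "k' differentiable (at x)"
  shows "dirder (\<lambda>y. c * k y + k' y) x u = c * dirder k x u + dirder k' x u"
proof -
  have "((\<lambda>y. c * k y + k' y) has_derivative (\<lambda>u. c * dirder k x u + dirder k' x u)) (at x)"
    using assms by (intro has_derivative_add has_derivative_mult_right has_derivative_dirder)
  from dirder_eqI[OF this] show ?thesis by simp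
qed

text \<open>
  The Hessian is linear in the function; this is used to compare the restrictions of \<open>h\<close> to two
  leaves of the base, whose difference is a multiple of \<open>f\<close>.
\<close>

lemma local_hessian_scaled_add:
  assumes S: "open S" "x \<in> S" and smooth: "smooth_on S h" "smooth_on S h'"
  shows "local_hessian G (\<lambda>y. c * h y + h' y) x u v =
     c * local_hessian G h x u v + local_hessian G h' x u v"
proof -
  note diff = smooth_on_imp_differentiable[OF smooth(1)] smooth_on_imp_differentiable[OF smooth(2)]
  note diff2 = smooth_on_imp_differentiable[OF smooth_on_dirder[OF smooth(1)] S(2)]
    smooth_on_imp_differentiable[OF smooth_on_dirder[OF smooth(2)] S(2)]
  have "dirder (\<lambda>y. dirder (\<lambda>y. c * h y + h' y) y v) x =
      dirder (\<lambda>y. c * dirder h y v + dirder h' y v) x"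
    by (rule dirder_cong_open[OF S]) (simp add: dirder_scaled_add diff)
  then show ?thesis
    using S(2) by (simp add: local_hessian_def dirder_scaled_add diff diff2) (simp add: algebra_simps)
qed

context warped_coordinates
begin

lemma local_hessian_horizontal:
  assumes x: "x \<in> S" and y: "y \<in> T" and H: "smooth_on (S \<times> T) H"
  shows "local_hessian G H (x, y) (u, 0) (v, 0) = local_hessian GB (\<lambda>x. H (x, y)) x u v"
proof -
  have diff: "H differentiable (at (x, y))" if "x \<in> S" for x
    using smooth_on_imp_differentiable[OF H] that y by simp
  have diff2: "(\<lambda>z. dirder H z (v, 0)) differentiable (at (x, y))"
    using smooth_on_imp_differentiable[OF smooth_on_dirder[OF H]] x y by simp
  have "dirder (\<lambda>z. dirder H z (v, 0)) (x, y) (u, 0) = dirder (\<lambda>x. dirder H (x, y) (v, 0)) x u"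
    using dirder_slice_fst[OF diff2] by simp
  also have "dirder (\<lambda>x. dirder H (x, y) (v, 0)) x = dirder (\<lambda>x. dirder (\<lambda>x. H (x, y)) x v) x"
    by (rule dirder_cong_open[OF base.open_S x]) (simp add: dirder_slice_fst diff)
  finally show ?thesis
    by (simp add: local_hessian_def christoffel_horizontal[OF x y] dirder_slice_fst[OF diff[OF x]])
qed

lemma local_hessian_mixed:
  assumes x: "x \<in> S" and y: "y \<in> T" and H: "smooth_on (S \<times> T) H"
  shows "local_hessian G H (x, y) (u, 0) (0, v) =
     dirder (\<lambda>x. dirder H (x, y) (0, v)) x u - dirder F x u / F x * dirder H (x, y) (0, v)"
proof -
  have "linear (dirder H (x, y))"
    using has_derivative_linear[OF has_derivative_dirder] smooth_on_imp_differentiable[OF H] x y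
    by blast
  from linear_scale[OF this, of _ "(0, v)"]
  have "dirder H (x, y) (0, (dirder F x u / F x) *\<^sub>R v) =
      dirder F x u / F x * dirder H (x, y) (0, v)" by simp
  moreover have "(\<lambda>z. dirder H z (0, v)) differentiable (at (x, y))"
    using smooth_on_imp_differentiable[OF smooth_on_dirder[OF H]] x y by simp
  note dirder_slice_fst[OF this, of u]
  ultimately show ?thesis
    by (simp add: local_hessian_def christoffel_mixed[OF x y])
qed

text \<open>
  By \<open>local_hessian_mixed\<close>, vanishing of the mixed Hessian says that the function
  \<open>k = dirder H (_, y) (0, v)\<close> of the base point satisfies \<open>dk = (dF / F) k\<close>, that is, \<open>d (k / F) = 0\<close>.
\<close>

lemma vertical_derivative_proportional:
  assumes H: "smooth_on (S \<times> T) H"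
    and mixed: "\<And>x y u v. x \<in> S \<Longrightarrow> y \<in> T \<Longrightarrow> local_hessian G H (x, y) (u, 0) (0, v) = 0"
    and C: "convex C" "C \<subseteq> S" and "x \<in> C" "x' \<in> C" "y \<in> T"
  shows "dirder H (x, y) (0, v) / F x = dirder H (x', y) (0, v) / F x'"
proof -
  have "((\<lambda>x. dirder H (x, y) (0, v) / F x) has_derivative (\<lambda>_. 0)) (at x within C)"
    if "x \<in> C" for x
  proof -
    have x: "x \<in> S" using that C(2) by blast
    have "(\<lambda>x. dirder H (x, y) (0, v)) differentiable (at x)"
      using smooth_on_imp_differentiable[OF smooth_on_slice[OF base.open_S \<open>y \<in> T\<close>
            smooth_on_dirder[OF H]] x] .
    then have "((\<lambda>x. dirder H (x, y) (0, v)) has_derivative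
        dirder (\<lambda>x. dirder H (x, y) (0, v)) x) (at x)"
      by (rule has_derivative_dirder)
    moreover have "dirder (\<lambda>x. dirder H (x, y) (0, v)) x =
        (\<lambda>u. dirder F x u / F x * dirder H (x, y) (0, v))"
      using mixed[OF x \<open>y \<in> T\<close>] by (simp add: local_hessian_mixed[OF x \<open>y \<in> T\<close> H] fun_eq_iff)
    ultimately have 1: "((\<lambda>x. dirder H (x, y) (0, v)) has_derivative
        (\<lambda>u. dirder F x u / F x * dirder H (x, y) (0, v))) (at x)" by simp
    note 2 = has_derivative_dirder[OF F_differentiable[OF x]]
    have "((\<lambda>x. dirder H (x, y) (0, v) / F x) has_derivative (\<lambda>_. 0)) (at x)"
      by (rule has_derivative_eq_rhs[OF has_derivative_divide'[OF 1 2 F_nonzero[OF x]]])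
        (simp add: F_nonzero[OF x])
    then show ?thesis by (rule has_derivative_at_withinI)
  qed
  from has_derivative_zero_constant[OF C(1) this] show ?thesis
    using \<open>x \<in> C\<close> \<open>x' \<in> C\<close> by metis
qed

text \<open>
  Integration of \<open>vertical_derivative_proportional\<close> along the fibre: for fixed \<open>x\<close> and \<open>x'\<close> the
  function \<open>y \<mapsto> H (x, y) / F x - H (x', y) / F x'\<close> has derivative 0 on a convex set.
\<close>

lemma fibre_difference_proportional:
  assumes H: "smooth_on (S \<times> T) H"
    and mixed: "\<And>x y u v. x \<in> S \<Longrightarrow> y \<in> T \<Longrightarrow> local_hessian G H (x, y) (u, 0) (0, v) = 0"
    and C: "convex C" "C \<subseteq> S" and D: "convex D" "D \<subseteq> T"
    and x: "x \<in> C" "x' \<in> C" and y: "y \<in> D" "y' \<in> D"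
  shows "(H (x, y) - H (x, y')) / F x = (H (x', y) - H (x', y')) / F x'"
proof -
  let ?E = "\<lambda>y. H (x, y) / F x - H (x', y) / F x'"
  have "(?E has_derivative (\<lambda>_. 0)) (at y within D)" if "y \<in> D" for y
  proof -
    have yT: "y \<in> T" using that D(2) by blast
    have slice: "((\<lambda>y. H (x, y)) has_derivative (\<lambda>v. dirder H (x, y) (0, v))) (at y)" if "x \<in> S" for x
    proof -
      have "H differentiable (at (x, y))"
        using smooth_on_imp_differentiable[OF H] that yT by simp
      then have "(H has_derivative dirder H (x, y)) (at (x, y))"
        by (rule has_derivative_dirder)
      moreover have "((\<lambda>y. (x, y)) has_derivative (\<lambda>v. (0, v))) (at y)"
        by (auto intro!: derivative_eq_intros)
      ultimately show ?thesis using has_derivative_compose by blast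
    qed
    have "(?E has_derivative
        (\<lambda>v. dirder H (x, y) (0, v) / F x - dirder H (x', y) (0, v) / F x')) (at y)"
      using x C(2) slice F_nonzero
      by (intro has_derivative_diff bounded_linear.has_derivative[OF bounded_linear_divide]) auto
    then show ?thesis
      using vertical_derivative_proportional[OF H mixed C x yT]
      by (simp add: has_derivative_at_withinI)
  qed
  from has_derivative_zero_constant[OF D(1) this] have "?E y = ?E y'"
    using y by metis
  then show ?thesis by (simp add: diff_divide_distrib)
qed

end

section \<open>Passing to the manifold\<close>

text \<open>
  Nondegeneracy of the metric gives that the tangent vector with coordinates \<open>z\<close> is 0 as a derivation;
  evaluating it on the coordinate functions shows \<open>z = 0\<close>.
\<close>

lemma coordinate_metric_local_metric:
  assumes A: "smooth_atlas A" and U: "(U, \<phi>) \<in> A" and g: "pseudo_riemannian_metric A g"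
  shows "coordinate_metric (\<phi> ` U) (local_metric A (U, \<phi>) g)"
proof
  show "open (\<phi> ` U)" using chart_open_image[OF A U open_UNIV] by simp
next
  fix x assume x: "x \<in> \<phi> ` U"
  define p where "p = inv_into U \<phi> x"
  have p: "p \<in> U" "\<phi> p = x" using x by (simp_all add: p_def inv_into_into f_inv_into_f)
  let ?c = "coord_tvec A (U, \<phi>) p"
  have G: "local_metric A (U, \<phi>) g x u v = g p (?c u) (?c v)" for u v
    by (simp add: local_metric_def Let_def p_def)
  have c: "?c u \<in> tangent_space A p" for u
    by (rule coord_tvec_in_tangent_space[OF U p(1)])
  have sym: "g p (?c u) (?c v) = g p (?c v) (?c u)" for u v
    using g c unfolding pseudo_riemannian_metric_def by blast
  have lin: "g p (?c (a *\<^sub>R u + b *\<^sub>R v)) (?c w) = a * g p (?c u) (?c w) + b * g p (?c v) (?c w)"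
    for a b u v w
    unfolding coord_tvec_linear[OF U p(1)]
    using g c unfolding pseudo_riemannian_metric_def by blast
  have add: "g p (?c (u + v)) (?c w) = g p (?c u) (?c w) + g p (?c v) (?c w)"
    and scale: "g p (?c (a *\<^sub>R u)) (?c w) = a * g p (?c u) (?c w)" for u v w a
    using lin[of 1 u 1 v w] lin[of a u 0 u w] by simp_all
  have add': "g p (?c w) (?c (u + v)) = g p (?c w) (?c u) + g p (?c w) (?c v)"
    and scale': "g p (?c w) (?c (a *\<^sub>R u)) = a * g p (?c w) (?c u)" for u v w a
    using add[of u v w] scale[of a u w] by (simp_all only: sym[of w])
  show "bilinear (local_metric A (U, \<phi>) g x)"
    unfolding bilinear_def G
    by (intro conjI allI linearI) (simp_all add: add scale add' scale')
  show "(\<lambda>y. local_metric A (U, \<phi>) g y u v) differentiable (at x)" for u v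
  proof (rule smooth_on_imp_differentiable[OF _ x])
    show "smooth_on (\<phi> ` U) (\<lambda>y. local_metric A (U, \<phi>) g y u v)"
      using g U unfolding pseudo_riemannian_metric_def by fastforce
  qed
  fix z assume z: "\<And>w. local_metric A (U, \<phi>) g x z w = 0"
  have "g p (?c z) v = 0" if v: "v \<in> tangent_space A p" for v
  proof -
    obtain w where "v = ?c w" using tangent_space_eq_coord_tvec[OF A U p(1) v] .
    then show ?thesis using z[of w] by (simp add: G)
  qed
  then have "?c z = (\<lambda>_. 0)"
    using g c unfolding pseudo_riemannian_metric_def by blast
  then show "z = 0"
    using components_coord_tvec[OF A U p(1), of z] by (simp add: components_def)
qed

lemma warped_coordinates_local_metric:
  assumes B: "smooth_atlas AB" "pseudo_riemannian_metric AB gB" "(U, \<phi>) \<in> AB"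
    and F: "smooth_atlas AF" "pseudo_riemannian_metric AF gF" "(V, \<psi>) \<in> AF"
    and f: "smooth_fun_on AB UNIV f" "\<And>p. f p \<noteq> 0"
  shows "warped_coordinates (\<phi> ` U) (local_metric AB (U, \<phi>) gB)
     (\<psi> ` V) (local_metric AF (V, \<psi>) gF) (f \<circ> inv_into U \<phi>)
     (local_metric (product_atlas AB AF) (U \<times> V, map_prod \<phi> \<psi>) (warped_metric gB f gF))"
proof -
  interpret base: coordinate_metric "\<phi> ` U" "local_metric AB (U, \<phi>) gB"
    using coordinate_metric_local_metric[OF B(1,3,2)] .
  interpret fibre: coordinate_metric "\<psi> ` V" "local_metric AF (V, \<psi>) gF"
    using coordinate_metric_local_metric[OF F(1,3,2)] .
  have "smooth_on (\<phi> ` U) (f \<circ> inv_into U \<phi>)"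
    using f(1) B(3) unfolding smooth_fun_on_def by fastforce
  then show ?thesis
    by unfold_locales
      (auto simp: f(2) local_metric_warped[OF B(1) F(1) B(3) _ F(3)] intro: smooth_on_imp_differentiable)
qed

text \<open>
  The Hessian of the potential function is a pointwise multiple of the metric, the factor being the
  scalar curvature minus \<open>\<rho>\<close>.
\<close>

lemma yamabe_soliton_local_hessian_eq_0:
  assumes B: "smooth_atlas AB" "(U, \<phi>) \<in> AB" and F: "smooth_atlas AF" "(V, \<psi>) \<in> AF"
    and sol: "gradient_yamabe_soliton (product_atlas AB AF) g h"
    and xy: "x \<in> \<phi> ` U" "y \<in> \<psi> ` V"
    and orth: "local_metric (product_atlas AB AF) (U \<times> V, map_prod \<phi> \<psi>) g (x, y) u v = 0"
  shows "local_hessian (local_metric (product_atlas AB AF) (U \<times> V, map_prod \<phi> \<psi>) g)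
     (h \<circ> inv_into (U \<times> V) (map_prod \<phi> \<psi>)) (x, y) u v = 0"
proof -
  let ?A = "product_atlas AB AF" and ?\<kappa> = "(U \<times> V, map_prod \<phi> \<psi>)"
  obtain p q where p: "p \<in> U" "x = \<phi> p" and q: "q \<in> V" "y = \<psi> q" using xy by blast
  have \<kappa>: "?\<kappa> \<in> ?A" using B(2) F(2) unfolding product_atlas_def by blast
  have pq: "(p, q) \<in> U \<times> V" using p q by simp
  have inv: "inv_into (U \<times> V) (map_prod \<phi> \<psi>) (x, y) = (p, q)"
    using inv_into_map_prod[OF chart_inj[OF B] chart_inj[OF F] xy] p q
      chart_inj[OF B] chart_inj[OF F] by simp
  let ?c = "coord_tvec ?A ?\<kappa> (p, q)"
  have comp: "components ?\<kappa> (?c w) = w" for w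
    using components_coord_tvec[OF B p(1)] components_coord_tvec[OF F q(1)]
    by (simp add: components_map_prod
        push_forward_coord_tvec[OF B(1) F(1) B(2) p(1) F(2) q(1)])
  obtain \<rho> where "\<forall>\<kappa>\<in>?A. \<forall>p\<in>fst \<kappa>. \<forall>v\<in>tangent_space ?A p. \<forall>w\<in>tangent_space ?A p.
      (scalar_curvature ?A \<kappa> g p - \<rho>) * g p v w = hessian ?A \<kappa> g h p v w"
    using sol unfolding gradient_yamabe_soliton_def by blast
  then have "(scalar_curvature ?A ?\<kappa> g (p, q) - \<rho>) * g (p, q) (?c u) (?c v) =
      hessian ?A ?\<kappa> g h (p, q) (?c u) (?c v)"
    using \<kappa> pq coord_tvec_in_tangent_space[OF \<kappa> pq] by (metis fst_conv)
  moreover have "g (p, q) (?c u) (?c v) = 0"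
    using orth by (simp add: local_metric_def Let_def inv)
  ultimately show ?thesis
    using p q by (simp add: hessian_def comp)
qed

text \<open>
  The identity says that \<open>e\<close> is a sum of a function of \<open>p\<close> and a function of \<open>q\<close>. It spreads from
  small boxes \<open>C \<times> D\<close> to the whole product in two steps, along the first factor for points of a fixed
  \<open>D\<close> and then along the second. For the first step to make sense, \<open>D\<close> must not depend on \<open>p0\<close>.
\<close>

lemma rectangle_identity:
  fixes e :: "'b::topological_space \<times> 'f::topological_space \<Rightarrow> real"
  assumes "connected (UNIV :: 'b set)" "connected (UNIV :: 'f set)"
    and loc: "\<And>q0. \<exists>D. open D \<and> q0 \<in> D \<and> (\<forall>p0. \<exists>C. open C \<and> p0 \<in> C \<and>
      (\<forall>p\<in>C. \<forall>p'\<in>C. \<forall>q\<in>D. \<forall>q'\<in>D. e (p, q) - e (p, q') = e (p', q) - e (p', q')))"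
  shows "e (p, q) - e (p, q') = e (p', q) - e (p', q')"
proof -
  have "\<exists>D. open D \<and> q0 \<in> D \<and>
      (\<forall>q\<in>D. \<forall>q'\<in>D. \<forall>p p'. e (p, q) - e (p, q') = e (p', q) - e (p', q'))" for q0
  proof -
    obtain D where D: "open D" "q0 \<in> D" "\<And>p0. \<exists>C. open C \<and> p0 \<in> C \<and>
        (\<forall>p\<in>C. \<forall>p'\<in>C. \<forall>q\<in>D. \<forall>q'\<in>D. e (p, q) - e (p, q') = e (p', q) - e (p', q'))"
      using loc[of q0] by auto
    have "e (p, q) - e (p, q') = e (p', q) - e (p', q')" if q: "q \<in> D" "q' \<in> D" for q q' p p'
    proof (rule connected_local_const[OF assms(1), where f = "\<lambda>p. e (p, q) - e (p, q')"])
      show "\<forall>p0\<in>UNIV. \<forall>\<^sub>F p in at p0. e (p0, q) - e (p0, q') = e (p, q) - e (p, q')"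
      proof
        fix p0
        obtain C where "open C" "p0 \<in> C"
          "\<forall>p\<in>C. \<forall>p'\<in>C. \<forall>q\<in>D. \<forall>q'\<in>D. e (p, q) - e (p, q') = e (p', q) - e (p', q')"
          using D(3)[of p0] by auto
        then show "\<forall>\<^sub>F p in at p0. e (p0, q) - e (p0, q') = e (p, q) - e (p, q')"
          using q unfolding eventually_at_topological by blast
      qed
    qed auto
    then show ?thesis using D(1,2) by blast
  qed
  note loc' = this
  have "e (p, q) - e (p', q) = e (p, q') - e (p', q')"
  proof (rule connected_local_const[OF assms(2), where f = "\<lambda>q. e (p, q) - e (p', q)"])
    show "\<forall>q0\<in>UNIV. \<forall>\<^sub>F q in at q0. e (p, q0) - e (p', q0) = e (p, q) - e (p', q)"
    proof
      fix q0
      obtain D where D: "open D" "q0 \<in> D"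
        "\<And>q q' p p'. q \<in> D \<Longrightarrow> q' \<in> D \<Longrightarrow> e (p, q) - e (p, q') = e (p', q) - e (p', q')"
        using loc'[of q0] by blast
      have "e (p, q0) - e (p', q0) = e (p, q) - e (p', q)" if "q \<in> D" for q
        using D(3)[OF D(2) that, of p p'] by linarith
      then show "\<forall>\<^sub>F q in at q0. e (p, q0) - e (p', q0) = e (p, q) - e (p', q)"
        using D(1,2) unfolding eventually_at_topological by blast
    qed
  qed auto
  then show ?thesis by linarith
qed

lemma convex_chart_neighbourhood:
  assumes A: "smooth_atlas A" and U: "(U, \<phi>) \<in> A" "p \<in> U"
  obtains C W where "convex C" "C \<subseteq> \<phi> ` U" "open W" "p \<in> W" "W \<subseteq> U" "\<phi> ` W \<subseteq> C"
proof -
  have "open (\<phi> ` U)" "\<phi> p \<in> \<phi> ` U"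
    using chart_open_image[OF A U(1) open_UNIV] U(2) by auto
  then obtain r where r: "r > 0" "ball (\<phi> p) r \<subseteq> \<phi> ` U"
    using open_contains_ball by blast
  show thesis
  proof
    show "convex (ball (\<phi> p) r)" by simp
    show "open (U \<inter> \<phi> -` ball (\<phi> p) r)"
      using continuous_open_preimage[OF chart_continuous[OF A U(1)] chart_open[OF A U(1)]] by simp
  qed (use r U in auto)
qed

theorem proposition1p1:
  fixes AB :: "('b::{t2_space, second_countable_topology}, 'm::euclidean_space) chart set"
    and AF :: "('f::{t2_space, second_countable_topology}, 'n::euclidean_space) chart set"
    and gB :: "'b metric" and gF :: "'f metric"
    and f :: "'b \<Rightarrow> real" and h :: "'b \<times> 'f \<Rightarrow> real"
  assumes "smooth_atlas AB" and "connected (UNIV :: 'b set)" and "pseudo_riemannian_metric AB gB"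
    and "smooth_atlas AF" and "connected (UNIV :: 'f set)" and "pseudo_riemannian_metric AF gF"
    and "DIM('n) > 1"
    and "smooth_fun_on AB UNIV f" and "\<forall>x. f x > 0"
    and "gradient_yamabe_soliton (product_atlas AB AF) (warped_metric gB f gF) h"
    and "\<exists>\<kappa>\<in>AB. \<exists>p\<in>fst \<kappa>. \<exists>X\<in>tangent_space AB p. \<exists>Y\<in>tangent_space AB p.
           gB p X Y = 0 \<and> hessian AB \<kappa> gB f p X Y \<noteq> 0"
  shows "\<forall>x y y'. h (x, y) = h (x, y')"
proof (intro allI)
  note B = assms(1,3) and F = assms(4,6) and sol = assms(10)
  have f_nonzero: "f p \<noteq> 0" for p using assms(9) less_irrefl[of 0] by metis
  note wc = warped_coordinates_local_metric[OF B _ F _ assms(8) f_nonzero]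
  have smooth_H: "smooth_on (\<phi> ` U \<times> \<psi> ` V) (h \<circ> inv_into (U \<times> V) (map_prod \<phi> \<psi>))"
    if "(U, \<phi>) \<in> AB" "(V, \<psi>) \<in> AF" for U \<phi> V \<psi>
  proof -
    have "(U \<times> V, map_prod \<phi> \<psi>) \<in> product_atlas AB AF"
      using that unfolding product_atlas_def by blast
    moreover have "smooth_fun_on (product_atlas AB AF) UNIV h"
      using sol unfolding gradient_yamabe_soliton_def by blast
    moreover have "map_prod \<phi> \<psi> ` ((U \<times> V) \<inter> UNIV) = \<phi> ` U \<times> \<psi> ` V"
      by auto
    ultimately show ?thesis unfolding smooth_fun_on_def by fastforce
  qed
  define e where "e z = h z / f (fst z)" for z
  \<comment> \<open>Horizontal and vertical vectors are orthogonal, so the mixed Hessian of \<open>h\<close> vanishes. A box around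
    \<open>(p0, q0)\<close> can be chosen with a fibre side that is independent of \<open>p0\<close>, because the product atlas
    contains the product of a fixed chart of the fibre with every chart of the base.\<close>
  have rect: "e (p, q) - e (p, q') = e (p', q) - e (p', q')" for p p' q q'
  proof (rule rectangle_identity[OF assms(2,5)])
    fix q0
    obtain V \<psi> where V: "(V, \<psi>) \<in> AF" "q0 \<in> V" using atlas_cover[OF F(1)] .
    obtain CF WF where CF: "convex CF" "CF \<subseteq> \<psi> ` V" "open WF" "q0 \<in> WF" "WF \<subseteq> V" "\<psi> ` WF \<subseteq> CF"
      using convex_chart_neighbourhood[OF F(1) V] .
    have "\<exists>C. open C \<and> p0 \<in> C \<and> (\<forall>p\<in>C. \<forall>p'\<in>C. \<forall>q\<in>WF. \<forall>q'\<in>WF.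
        e (p, q) - e (p, q') = e (p', q) - e (p', q'))" for p0
    proof -
      obtain U \<phi> where U: "(U, \<phi>) \<in> AB" "p0 \<in> U" using atlas_cover[OF B(1)] .
      obtain CB WB where CB: "convex CB" "CB \<subseteq> \<phi> ` U" "open WB" "p0 \<in> WB" "WB \<subseteq> U" "\<phi> ` WB \<subseteq> CB"
        using convex_chart_neighbourhood[OF B(1) U] .
      note inj = chart_inj[OF B(1) U(1)] chart_inj[OF F(1) V(1)]
      interpret warped_coordinates "\<phi> ` U" "local_metric AB (U, \<phi>) gB"
        "\<psi> ` V" "local_metric AF (V, \<psi>) gF" "f \<circ> inv_into U \<phi>"
        "local_metric (product_atlas AB AF) (U \<times> V, map_prod \<phi> \<psi>) (warped_metric gB f gF)"
        using wc[OF U(1) V(1)] .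
      let ?H = "h \<circ> inv_into (U \<times> V) (map_prod \<phi> \<psi>)"
      have "e (p, q) - e (p, q') = e (p', q) - e (p', q')"
        if "p \<in> WB" "p' \<in> WB" "q \<in> WF" "q' \<in> WF" for p p' q q'
      proof -
        have inv: "inv_into U \<phi> (\<phi> p) = p" if "p \<in> WB" for p
          using that CB(5) inj by auto
        have H: "?H (\<phi> p, \<psi> q) = h (p, q)" if "p \<in> WB" "q \<in> WF" for p q
        proof -
          have "p \<in> U" "q \<in> V" using that CB(5) CF(5) by auto
          then show ?thesis by (simp add: inv_into_map_prod[OF inj] inj)
        qed
        have "(?H (\<phi> p, \<psi> q) - ?H (\<phi> p, \<psi> q')) / (f \<circ> inv_into U \<phi>) (\<phi> p) =
            (?H (\<phi> p', \<psi> q) - ?H (\<phi> p', \<psi> q')) / (f \<circ> inv_into U \<phi>) (\<phi> p')"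
        proof (rule fibre_difference_proportional[OF smooth_H[OF U(1) V(1)] _ CB(1,2) CF(1,2)])
          fix x y u v assume xy: "x \<in> \<phi> ` U" "y \<in> \<psi> ` V"
          show "local_hessian (local_metric (product_atlas AB AF) (U \<times> V, map_prod \<phi> \<psi>)
              (warped_metric gB f gF)) ?H (x, y) (u, 0) (0, v) = 0"
            by (rule yamabe_soliton_local_hessian_eq_0[OF B(1) U(1) F(1) V(1) sol xy])
              (simp add: warped[OF xy] bilinear_rzero[OF base.bilinear[OF xy(1)]]
                bilinear_lzero[OF fibre.bilinear[OF xy(2)]])
        qed (use that CB CF in auto)
        then show ?thesis
          by (simp add: H that e_def diff_divide_distrib del: o_apply)
             (simp add: inv that)
      qed
      then show ?thesis using CB(3,4) by blast
    qed
    then show "\<exists>D. open D \<and> q0 \<in> D \<and> (\<forall>p0. \<exists>C. open C \<and> p0 \<in> C \<and>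
        (\<forall>p\<in>C. \<forall>p'\<in>C. \<forall>q\<in>D. \<forall>q'\<in>D. e (p, q) - e (p, q') = e (p', q) - e (p', q')))"
      using CF(3,4) by blast
  qed
  fix x y y'
  obtain U \<phi> p X Y where U: "(U, \<phi>) \<in> AB" "p \<in> U"
    and XY: "X \<in> tangent_space AB p" "Y \<in> tangent_space AB p" "gB p X Y = 0"
      "hessian AB (U, \<phi>) gB f p X Y \<noteq> 0"
    using assms(11) by auto
  obtain u v where u: "X = coord_tvec AB (U, \<phi>) p u" and v: "Y = coord_tvec AB (U, \<phi>) p v"
    using tangent_space_eq_coord_tvec[OF B(1) U] XY(1,2) by metis
  let ?GB = "local_metric AB (U, \<phi>) gB" and ?S = "\<phi> ` U"
  have S: "open ?S" "\<phi> p \<in> ?S" using chart_open_image[OF B(1) U(1) open_UNIV] U(2) by auto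
  have hess_f: "local_hessian ?GB (f \<circ> inv_into U \<phi>) (\<phi> p) u v \<noteq> 0"
    using XY(4) by (simp add: hessian_def u v components_coord_tvec[OF B(1) U])
  have orth: "?GB (\<phi> p) u v = 0"
    using XY(3) U chart_inj[OF B(1) U(1)] by (simp add: local_metric_def Let_def u v)
  \<comment> \<open>The vectors \<open>X\<close> and \<open>Y\<close> lift to orthogonal horizontal vectors at \<open>(p, q)\<close> for every point \<open>q\<close> of the
    fibre, and the Hessian of \<open>h\<close> on the lifts is the base Hessian of \<open>h\<close> restricted to the leaf
    through \<open>q\<close>.\<close>
  have slice: "smooth_on ?S (\<lambda>x. h (inv_into U \<phi> x, q)) \<and>
      local_hessian ?GB (\<lambda>x. h (inv_into U \<phi> x, q)) (\<phi> p) u v = 0" for q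
  proof -
    obtain V \<psi> where V: "(V, \<psi>) \<in> AF" "q \<in> V" using atlas_cover[OF F(1)] .
    note inj = chart_inj[OF B(1) U(1)] chart_inj[OF F(1) V(1)]
    interpret warped_coordinates ?S ?GB
      "\<psi> ` V" "local_metric AF (V, \<psi>) gF" "f \<circ> inv_into U \<phi>"
      "local_metric (product_atlas AB AF) (U \<times> V, map_prod \<phi> \<psi>) (warped_metric gB f gF)"
      using wc[OF U(1) V(1)] .
    let ?H = "h \<circ> inv_into (U \<times> V) (map_prod \<phi> \<psi>)"
    have q: "\<psi> q \<in> \<psi> ` V" using V(2) by simp
    have H: "?H (x, \<psi> q) = h (inv_into U \<phi> x, q)" if "x \<in> ?S" for x
      using inv_into_map_prod[OF inj that q] V(2) inj by simp
    have "local_hessian (local_metric (product_atlas AB AF) (U \<times> V, map_prod \<phi> \<psi>)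
        (warped_metric gB f gF)) ?H (\<phi> p, \<psi> q) (u, 0) (v, 0) = 0"
      by (rule yamabe_soliton_local_hessian_eq_0[OF B(1) U(1) F(1) V(1) sol S(2) q])
        (simp add: warped[OF S(2) q] orth bilinear_rzero[OF fibre.bilinear[OF q]])
    then have "local_hessian ?GB (\<lambda>x. ?H (x, \<psi> q)) (\<phi> p) u v = 0"
      by (simp only: local_hessian_horizontal[OF S(2) q smooth_H[OF U(1) V(1)]])
    then show ?thesis
      using local_hessian_cong_open[OF S H] smooth_on_cong[OF S(1) H]
        smooth_on_slice[OF S(1) q smooth_H[OF U(1) V(1)]] by simp
  qed
  \<comment> \<open>By \<open>rect\<close>, the base point in this definition is immaterial.\<close>
  define c where "c = e (x, y) - e (x, y')"
  have diff: "h (p, y) = c * f p + h (p, y')" for p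
    using rect[of p y y' x] f_nonzero[of p] by (simp add: c_def e_def field_simps)
  have "smooth_on ?S (f \<circ> inv_into U \<phi>)"
    using assms(8) U(1) unfolding smooth_fun_on_def by fastforce
  then have "local_hessian ?GB (\<lambda>x. c * (f \<circ> inv_into U \<phi>) x + h (inv_into U \<phi> x, y')) (\<phi> p) u v =
      c * local_hessian ?GB (f \<circ> inv_into U \<phi>) (\<phi> p) u v
      + local_hessian ?GB (\<lambda>x. h (inv_into U \<phi> x, y')) (\<phi> p) u v"
    using slice by (intro local_hessian_scaled_add[OF S]) blast+
  moreover have "(\<lambda>x. c * (f \<circ> inv_into U \<phi>) x + h (inv_into U \<phi> x, y')) =
      (\<lambda>x. h (inv_into U \<phi> x, y))"
    by (simp add: diff[symmetric])
  ultimately have "c = 0" using slice hess_f by simp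
  then show "h (x, y) = h (x, y')" using diff by simp
qed

end
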